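(* There is an equivalence relation $\sim$ on $\mathbb{R}$ such that, letting $S:=\mathbb{R}/\sim$, there is no good $S$-predictor on $\mathbb{R}$ that is anonymous with respect to $D^\infty_{\mathrm{Lip}}$; in fact there is no good weak $S$-predictor that is anonymous with respect to $D^\infty_{\mathrm{Lip}}$.
   Context: $D^\infty_{\mathrm{Lip}}$ (the infinitely Lipschitz diffeomorphisms) is the set of increasing bijections $f:\mathbb{R}\to\mathbb{R}$ such that $f$ and $f^{-1}$ are $C^\infty$ and for every $k\ge 1$ the derivatives $f^{(k)}$ and $(f^{-1})^{(k)}$ are bounded on $\mathbb{R}$. An $S$-predictor is a function $\mathcal{P}$ from the set of $S$-valued functions with domain $(-\infty,t_f)$ for some $t_f\in\mathbb{R}$ into $S$; it is good if for every $F:\mathbb{R}\to S$ the set $\{t:\mathcal{P}(F|_{(-\infty,t)})\ne F(t)\}$ has Lebesgue measure zero; for $U\subseteq\mathrm{Homeo}^+(\mathbb{R})$ (increasing homeomorphisms) it is $U$-anonymous if $\mathcal{P}(f)=\mathcal{P}(f\circ\varphi)$ for all such $f$ and all $\varphi\in U$, where $f\circ\varphi$ has domain $(-\infty,\varphi^{-1}(t_f))$. A weak $S$-predictor is a function $\mathcal{Q}$ from the set of $S$-valued functions $f$ with domain $\mathbb{R}\setminus\{h_f\}$ for some $h_f\in\mathbb{R}$ into $S$. It is good if for every $F:\mathbb{R}\to S$ the set $\{x:\mathcal{Q}(F|_{\mathbb{R}\setminus\{x\}})\neq F(x)\}$ has Lebesgue measure zero. For $U\subseteq\mathrm{Homeo}^+(\mathbb{R})$,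 $\mathcal{Q}$ is $U$-anonymous if whenever $f,g$ are such functions with holes $h_f,h_g$, $\varphi\in U$, $\varphi(h_f)=h_g$ and $f=(g\circ\varphi)|_{\mathbb{R}\setminus\{h_f\}}$, then $\mathcal{Q}(f)=\mathcal{Q}(g)$. *)

theory Defs
  imports "HOL-Analysis.Analysis"
begin

definition smooth_real :: "(real \<Rightarrow> real) \<Rightarrow> bool" where
  "smooth_real f \<longleftrightarrow> (\<forall>k::nat. \<forall>x. ((deriv ^^ k) f) differentiable (at x))"

definition Dinf_Lip :: "(real \<Rightarrow> real) set" where
  "Dinf_Lip = {f. strict_mono f \<and> bij f \<and> smooth_real f \<and> smooth_real (inv f) \<and>
      (\<forall>k::nat. k \<ge> 1 \<longrightarrow> bounded (range ((deriv ^^ k) f)) \<and> bounded (range ((deriv ^^ k) (inv f))))}"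

text \<open>An \<open>S\<close>-predictor: total on maps, required to land in \<open>S\<close> on its intended domain
  (S-valued functions with domain \<open>(-\<infinity>,t)\<close>); values elsewhere are irrelevant.\<close>
definition is_predictor :: "'a set \<Rightarrow> ((real \<Rightarrow> 'a option) \<Rightarrow> 'a) \<Rightarrow> bool" where
  "is_predictor S P \<longleftrightarrow> (\<forall>t f. dom f = {..<t} \<and> ran f \<subseteq> S \<longrightarrow> P f \<in> S)"

definition good_predictor :: "'a set \<Rightarrow> ((real \<Rightarrow> 'a option) \<Rightarrow> 'a) \<Rightarrow> bool" where
  "good_predictor S P \<longleftrightarrow> (\<forall>F :: real \<Rightarrow> 'a. range F \<subseteq> S \<longrightarrow>
      {t. P ((Some \<circ> F) |` {..<t}) \<noteq> F t} \<in> null_sets lebesgue)"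

definition anonymous_predictor :: "'a set \<Rightarrow> (real \<Rightarrow> real) set \<Rightarrow> ((real \<Rightarrow> 'a option) \<Rightarrow> 'a) \<Rightarrow> bool" where
  "anonymous_predictor S U P \<longleftrightarrow> (\<forall>t f \<phi>. dom f = {..<t} \<and> ran f \<subseteq> S \<and> \<phi> \<in> U \<longrightarrow>
      P f = P (f \<circ> \<phi>))"

definition is_weak_predictor :: "'a set \<Rightarrow> ((real \<Rightarrow> 'a option) \<Rightarrow> 'a) \<Rightarrow> bool" where
  "is_weak_predictor S Q \<longleftrightarrow> (\<forall>h f. dom f = - {h} \<and> ran f \<subseteq> S \<longrightarrow> Q f \<in> S)"

definition good_weak_predictor :: "'a set \<Rightarrow> ((real \<Rightarrow> 'a option) \<Rightarrow> 'a) \<Rightarrow> bool" where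
  "good_weak_predictor S Q \<longleftrightarrow> (\<forall>F :: real \<Rightarrow> 'a. range F \<subseteq> S \<longrightarrow>
      {x. Q ((Some \<circ> F) |` (- {x})) \<noteq> F x} \<in> null_sets lebesgue)"

definition anonymous_weak_predictor :: "'a set \<Rightarrow> (real \<Rightarrow> real) set \<Rightarrow> ((real \<Rightarrow> 'a option) \<Rightarrow> 'a) \<Rightarrow> bool" where
  "anonymous_weak_predictor S U Q \<longleftrightarrow> (\<forall>f g hf hg \<phi>.
      dom f = - {hf} \<and> ran f \<subseteq> S \<and> dom g = - {hg} \<and> ran g \<subseteq> S \<and> \<phi> \<in> U \<and> \<phi> hf = hg \<and>
      f = (g \<circ> \<phi>) |` (- {hf}) \<longrightarrow> Q f = Q g)"

end

theory Submission
  imports Defs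
begin

unbundle cardinal_syntax

text \<open>
  It suffices to find diffeomorphisms \<open>\<phi>\<^sub>i\<close> in \<open>D\<^sup>\<infinity>\<^sub>L\<^sub>i\<^sub>p\<close> and points \<open>z\<^sub>i\<close> such that no null set meets all
  the pairs \<open>{z\<^sub>i, \<phi>\<^sub>i z\<^sub>i}\<close>, and such that \<open>z\<^sub>i\<close> and \<open>\<phi>\<^sub>i z\<^sub>i\<close> are inequivalent for the equivalence
  relation \<open>\<sim>\<close> generated by \<open>y \<sim> \<phi>\<^sub>j y\<close> for all \<open>j\<close> and all \<open>y \<noteq> z\<^sub>j\<close>. For the quotient map \<open>F\<close>, an
  anonymous predictor makes the same guess at \<open>z\<^sub>i\<close> and at \<open>\<phi>\<^sub>i z\<^sub>i\<close>, since \<open>F \<circ> \<phi>\<^sub>i = F\<close> away from \<open>z\<^sub>i\<close>;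
  so it errs at one of them.

  The inequivalence follows if no nonempty reduced word in the \<open>\<phi>\<^sub>j\<close> fixes a \<open>z\<^sub>i\<close>. For \<open>\<phi>\<^sub>i\<close> take
  the lift to \<open>\<real>\<close> of the action on rays of the positive definite matrix \<open>M\<^sub>i\<close> that stretches the line through
  \<open>(s\<^sub>i, 1)\<close> by \<open>t\<^sub>i\<close>; lifts of this kind commute with translation by \<open>\<pi>\<close>, hence have bounded
  derivatives. The parameters \<open>s\<^sub>i\<close>, \<open>t\<^sub>i\<close>, \<open>cot z\<^sub>i\<close> are chosen by recursion along a well-order of
  \<open>\<real>\<close> of minimal type, each outside the real algebraic closure of the earlier ones, while \<open>z\<^sub>i\<close> and
  \<open>\<phi>\<^sub>i z\<^sub>i\<close> avoid the \<open>i\<close>-th null set. If \<open>g\<close> is the largest index in a word \<open>w\<close>, the leading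
  coefficient of \<open>M\<^sub>w\<close> in \<open>t\<^sub>g\<close> shows that \<open>w\<close> moves all earlier lines; and \<open>cot z\<^sub>i\<close> is not fixed by a word in
  indices up to \<open>i\<close>, because it is not quadratic over their entries.
\<close>

section \<open>Root-closed subfields of the reals\<close>

text \<open>These are the subfields of \<real> that are algebraically closed in \<real>: negatives
  and inverses are roots of linear polynomials.\<close>

definition root_closed :: "real set \<Rightarrow> bool" where
  "root_closed K \<longleftrightarrow> 0 \<in> K \<and> 1 \<in> K \<and> (\<forall>x\<in>K. \<forall>y\<in>K. x + y \<in> K \<and> x * y \<in> K) \<and>
     (\<forall>p x. p \<noteq> 0 \<and> (\<forall>i. coeff p i \<in> K) \<and> poly p x = 0 \<longrightarrow> x \<in> K)"

abbreviation rcl :: "real set \<Rightarrow> real set" where "rcl A \<equiv> root_closed hull A"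

lemma root_closed_hull: "root_closed (rcl A)"
proof (rule hull_in)
  fix T assume *: "Ball T root_closed"
  show "root_closed (\<Inter>T)"
    unfolding root_closed_def
  proof (intro conjI ballI allI impI)
    fix p x assume p: "p \<noteq> 0 \<and> (\<forall>i. coeff p i \<in> \<Inter>T) \<and> poly p x = 0"
    show "x \<in> \<Inter>T"
    proof
      fix K assume "K \<in> T"
      with * p show "x \<in> K" unfolding root_closed_def by (metis InterD)
    qed
  qed (use * in \<open>auto simp: root_closed_def\<close>)
qed

section \<open>Cardinality of root closures\<close>

lemma card_of_lists_ordLeq:
  assumes "infinite C" shows "|lists C| \<le>o |C|"
proof -
  define L where "L n = {xs \<in> lists C. length xs = n}" for n
  have "|L n| \<le>o |C|" for n
  proof (induction n)
    case 0
    have "L 0 = {[]}" by (auto simp: L_def)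
    then show ?case using assms by (simp add: card_of_singl_ordLeq infinite_imp_nonempty)
  next
    case (Suc n)
    have "L (Suc n) \<subseteq> (\<Union>c\<in>C. (#) c ` L n)"
      by (auto simp: L_def length_Suc_conv image_iff)
    moreover have "|\<Union>c\<in>C. (#) c ` L n| \<le>o |C|"
      using assms Suc card_of_image ordLeq_transitive card_of_refl ordIso_imp_ordLeq
      by (intro card_of_UNION_ordLeq_infinite) blast+
    ultimately show ?case using card_of_mono1 ordLeq_transitive by blast
  qed
  then have "|\<Union>n. L n| \<le>o |C|"
    using assms by (intro card_of_UNION_ordLeq_infinite) (auto simp: infinite_iff_card_of_nat)
  moreover have "(\<Union>n. L n) = lists C" by (auto simp: L_def)
  ultimately show ?thesis by simp
qed

text \<open>One round towards the closure. Polynomials are given by coefficient lists, so that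
  \<open>card_of_lists_ordLeq\<close> bounds their number.\<close>

definition adjoin_roots :: "real set \<Rightarrow> real set" where
  "adjoin_roots C = C \<union> (\<lambda>(x, y). x + y) ` (C \<times> C) \<union> (\<lambda>(x, y). x * y) ` (C \<times> C) \<union>
     (\<Union>cs\<in>lists C. if Poly cs = 0 then {} else {x. poly (Poly cs) x = 0})"

lemma card_adjoin_roots:
  assumes "infinite C" shows "|adjoin_roots C| \<le>o |C|"
proof -
  have CC: "|C \<times> C| \<le>o |C|"
    using assms by (simp add: card_of_Times_same_infinite ordIso_imp_ordLeq)
  have "|\<Union>cs\<in>lists C. if Poly cs = 0 then {} else {x. poly (Poly cs) x = 0}| \<le>o |C|"
  proof (intro card_of_UNION_ordLeq_infinite[OF assms card_of_lists_ordLeq[OF assms]] ballI)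
    fix cs assume "cs \<in> lists C"
    have "finite (if Poly cs = 0 then {} else {x. poly (Poly cs) x = 0})"
      by (simp add: poly_roots_finite)
    then show "|if Poly cs = 0 then {} else {x. poly (Poly cs) x = 0}| \<le>o |C|"
      using assms card_of_ordLeq_finite ordLess_or_ordLeq[OF card_of_Well_order card_of_Well_order]
        ordLess_imp_ordLeq by blast
  qed
  moreover have "|(\<lambda>(x, y). x + y) ` (C \<times> C)| \<le>o |C|" "|(\<lambda>(x, y). x * y) ` (C \<times> C)| \<le>o |C|"
    using CC card_of_image ordLeq_transitive by blast+
  ultimately show ?thesis
    unfolding adjoin_roots_def
    by (intro card_of_Un_ordLeq_infinite_Field) (simp_all add: assms card_of_card_order_on Field_card_of card_of_refl ordIso_imp_ordLeq)
qed

text \<open>The closure lies in the union of countably many rounds of \<open>adjoin_roots\<close>,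
  none of which enlarges the cardinality of an infinite set.\<close>

lemma card_rcl_less:
  assumes "|A| <o |UNIV :: real set|"
  shows "|rcl A| <o |UNIV :: real set|"
proof -
  \<comment> \<open>Adding \<open>\<nat>\<close> makes the start infinite even when \<open>A\<close>
    is finite, and supplies 0 and 1.\<close>
  define B where "B = A \<union> \<nat>"
  define D where "D n = (adjoin_roots ^^ n) B" for n
  have "|\<nat> :: real set| <o |UNIV :: real set|"
  proof -
    have "\<not> |UNIV :: real set| \<le>o |\<nat> :: real set|"
      using card_of_ordLeq[of "UNIV::real set" "\<nat>::real set"] uncountable_UNIV_real
      by (metis Nats_def countableI_type countable_image countable_subset countable_image_inj_on)
    then show ?thesis
      using ordLess_or_ordLeq[OF card_of_Well_order card_of_Well_order] by blast
  qed
  then have B: "|B| <o |UNIV :: real set|"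
    unfolding B_def using assms by (intro card_of_Un_ordLess_infinite) (auto simp: infinite_UNIV_char_0)
  have infB: "infinite B" unfolding B_def by (simp add: Nats_def range_inj_infinite inj_of_nat)
  have subS: "D n \<subseteq> D (Suc n)" for n by (auto simp: D_def adjoin_roots_def)
  have mono: "D m \<subseteq> D n" if "m \<le> n" for m n using subS that by (rule lift_Suc_mono_le)
  have inf: "infinite (D n)" for n
    using mono[of 0 n] infB by (auto simp: D_def dest: finite_subset)
  have cD: "|D n| \<le>o |B|" for n
  proof (induction n)
    case 0 then show ?case by (simp add: D_def card_of_refl ordIso_imp_ordLeq)
  next
    case (Suc n)
    then show ?case using card_adjoin_roots[OF inf[of n]] ordLeq_transitive by (auto simp: D_def)
  qed
  have "rcl A \<subseteq> (\<Union>n. D n)"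
  proof (rule hull_minimal)
    have "A \<subseteq> D 0" by (auto simp: D_def B_def)
    then show "A \<subseteq> (\<Union>n. D n)" by blast
    have two: "\<exists>n. x \<in> D n \<and> y \<in> D n" if "x \<in> (\<Union>n. D n)" "y \<in> (\<Union>n. D n)" for x y
    proof -
      from that obtain m n where "x \<in> D m" "y \<in> D n" by blast
      then have "x \<in> D (max m n)" "y \<in> D (max m n)"
        using mono[of m "max m n"] mono[of n "max m n"] by auto
      then show ?thesis by blast
    qed
    show "root_closed (\<Union>n. D n)"
      unfolding root_closed_def
    proof (intro conjI ballI allI impI)
      have "0 \<in> D 0" "1 \<in> D 0" by (auto simp: D_def B_def)
      then show "0 \<in> (\<Union>n. D n)" "1 \<in> (\<Union>n. D n)" by blast+
    next
      fix x y assume "x \<in> (\<Union>n. D n)" "y \<in> (\<Union>n. D n)"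
      from two[OF this] obtain n where "x \<in> D n" "y \<in> D n" by blast
      then have "x + y \<in> D (Suc n)" "x * y \<in> D (Suc n)"
        by (auto simp: D_def adjoin_roots_def)
      then show "x + y \<in> (\<Union>n. D n)" "x * y \<in> (\<Union>n. D n)" by blast+
    next
      fix p :: "real poly" and x
      assume p: "p \<noteq> 0 \<and> (\<forall>i. coeff p i \<in> (\<Union>n. D n)) \<and> poly p x = 0"
      \<comment> \<open>A polynomial has finitely many coefficients, so a single stage contains them
        all.\<close>
      have "\<exists>n. S \<subseteq> D n" if "finite S" "S \<subseteq> (\<Union>n. D n)" for S
        using that
      proof (induction S)
        case (insert a S)
        then obtain m n where "a \<in> D m" "S \<subseteq> D n" by auto
        then have "insert a S \<subseteq> D (max m n)"
          using mono[of m "max m n"] mono[of n "max m n"] by auto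
        then show ?case by blast
      qed auto
      moreover have "set (coeffs p) \<subseteq> (\<Union>n. D n)" using p by (auto simp: coeffs_def)
      ultimately obtain n where "set (coeffs p) \<subseteq> D n" by (metis List.finite_set)
      then have "coeffs p \<in> lists (D n)" by (auto simp: lists_eq_set)
      then have "x \<in> adjoin_roots (D n)"
        unfolding adjoin_roots_def using p by (auto intro!: bexI[of _ "coeffs p"])
      then have "x \<in> D (Suc n)" by (simp add: D_def)
      then show "x \<in> (\<Union>n. D n)" by blast
    qed
  qed
  moreover have "|\<Union>n. D n| \<le>o |B|"
    using cD infB by (intro card_of_UNION_ordLeq_infinite) (auto simp: infinite_iff_card_of_nat)
  ultimately show ?thesis
    using B card_of_mono1 ordLeq_ordLess_trans by meson
qed

lemma rcl_ne_UNIV: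
  assumes "|A| <o |UNIV :: real set|"
  shows "rcl A \<noteq> UNIV"
  using card_rcl_less[OF assms] ordLess_irreflexive by metis

lemma root_closed_neg:
  assumes "root_closed K" "x \<in> K" shows "- x \<in> K"
proof -
  have "coeff [:x, 1:] i \<in> K" for i
    using assms by (auto simp: root_closed_def coeff_pCons split: nat.splits)
  moreover have "[:x, 1:] \<noteq> 0" "poly [:x, 1:] (- x) = 0" by simp_all
  ultimately show ?thesis using assms(1) unfolding root_closed_def by blast
qed

lemma root_closed_diff: "root_closed K \<Longrightarrow> x \<in> K \<Longrightarrow> y \<in> K \<Longrightarrow> x - y \<in> K"
  using root_closed_neg[of K y] by (auto simp: root_closed_def diff_conv_add_uminus simp del: add_uminus_conv_diff)

text \<open>Mostly used in reverse: a number outside \<open>K\<close> satisfies no nontrivial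
  equation of degree at most two over \<open>K\<close>. Linear equations are the case
  \<open>a = 0\<close>.\<close>

lemma root_closed_quadratic_root:
  assumes K: "root_closed K" and "a \<in> K" "b \<in> K" "c \<in> K" "a \<noteq> 0 \<or> b \<noteq> 0"
    and "a * x\<^sup>2 + b * x + c = 0"
  shows "x \<in> K"
proof -
  have "coeff [:c, b, a:] i \<in> K" for i
    using assms by (auto simp: root_closed_def coeff_pCons split: nat.splits)
  moreover have "[:c, b, a:] \<noteq> 0" "poly [:c, b, a:] x = 0"
    using assms by (auto simp: algebra_simps power2_eq_square)
  ultimately show ?thesis using K unfolding root_closed_def by blast
qed

section \<open>Null sets\<close>

text \<open>Every null set lies in a null \<open>G\<^sub>\<delta>\<close> set, and these are coded by sets of naturals.\<close>

lemma cofinal_negligible_family: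
  obtains N :: "real \<Rightarrow> real set"
  where "\<And>i. negligible (N i)" "\<And>B. negligible B \<Longrightarrow> \<exists>i. B \<subseteq> N i"
proof -
  \<comment> \<open>Indexing by reals lets the later recursion along \<real> treat one null set at
    each stage.\<close>
  obtain h :: "real \<Rightarrow> nat set" where h: "surj h"
    using nat_sets_eqpoll_reals unfolding eqpoll_def by (metis bij_betw_def bij_betw_inv)
  obtain \<B> :: "nat \<Rightarrow> real set" where \<B>: "\<And>S. open S \<Longrightarrow> \<exists>k. S = \<Union>{\<B> n | n. n \<in> k}"
    by (metis Setcompr_eq_image univ_second_countable_sequence)
  \<comment> \<open>Through \<open>prod_encode\<close>, \<open>h i\<close> codes a sequence of index
    sets, hence a sequence of open sets; \<open>G i\<close> is their intersection.\<close>
  define G where "G i = (\<Inter>m. \<Union>{\<B> n | n. prod_encode (m, n) \<in> h i})" for i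
  \<comment> \<open>Codes of sets that are not null are sent to \<open>{}\<close>, so that every
    \<open>N i\<close> is null.\<close>
  define N where "N i = (if negligible (G i) then G i else {})" for i
  have "\<exists>i. B \<subseteq> N i" if B: "negligible B" for B
  proof -
    have "\<exists>T. open T \<and> B \<subseteq> T \<and> T \<in> lmeasurable \<and> measure lebesgue T < 1 / real (Suc m)" for m
    proof -
      obtain T where "open T" "B \<subseteq> T" "T - B \<in> lmeasurable"
        "emeasure lebesgue (T - B) < ennreal (1 / real (Suc m))"
        using sets_lebesgue_outer_open[of B "1 / real (Suc m)"] B negligible_imp_sets by auto
      moreover have "T = (T - B) \<union> B" using \<open>B \<subseteq> T\<close> by auto
      moreover have "B \<in> null_sets lebesgue" using B negligible_iff_null_sets by blast
      ultimately have "T \<in> lmeasurable" by (metis fmeasurable.Un fmeasurableI_null_sets)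
      moreover have "measure lebesgue T = measure lebesgue (T - B)"
        by (metis \<open>T - B \<in> lmeasurable\<close> \<open>T = T - B \<union> B\<close> measure_Un_null_set fmeasurableD \<open>B \<in> null_sets lebesgue\<close>)
      moreover have "measure lebesgue (T - B) < 1 / real (Suc m)"
        using \<open>emeasure lebesgue (T - B) < _\<close> \<open>T - B \<in> lmeasurable\<close>
        by (simp add: emeasure_eq_measure2 ennreal_less_iff)
      ultimately show ?thesis using \<open>open T\<close> \<open>B \<subseteq> T\<close> by auto
    qed
    then obtain T where T: "\<And>m. open (T m)" "\<And>m. B \<subseteq> T m" "\<And>m. T m \<in> lmeasurable"
        "\<And>m. measure lebesgue (T m) < 1 / real (Suc m)" by metis
    have "\<forall>m. \<exists>k. T m = \<Union>{\<B> n | n. n \<in> k}" using \<B>[OF T(1)] by blast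
    from choice[OF this] obtain k where k: "\<And>m. T m = \<Union>{\<B> n | n. n \<in> k m}" by blast
    obtain i where i: "prod_encode ` {(m, n). n \<in> k m} = h i"
      using surjD[OF h, of "prod_encode ` {(m, n). n \<in> k m}"] by (elim exE)
    have "prod_encode (m, n) \<in> h i \<longleftrightarrow> n \<in> k m" for m n
      unfolding i[symmetric] by (simp add: image_iff)
    then have "G i = (\<Inter>m. T m)" by (simp only: G_def k)
    moreover have "negligible (\<Inter>m. T m)"
      unfolding negligible_outer
    proof (intro allI impI)
      fix e :: real assume "e > 0"
      then obtain m where "1 / real (Suc m) < e" by (metis nat_approx_posE)
      then show "\<exists>U. (\<Inter>m. T m) \<subseteq> U \<and> U \<in> lmeasurable \<and> measure lebesgue U < e"
        using T(3,4)[of m] by (intro exI[of _ "T m"]) auto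
    qed
    ultimately have "B \<subseteq> N i" using T(2) by (auto simp: N_def)
    then show ?thesis ..
  qed
  then show ?thesis using that[of N] by (auto simp: N_def)
qed

text \<open>The differences of a conull set are all of \<open>\<real>\<close>, and \<open>cot (\<alpha> - \<beta>)\<close> is algebraic
  over \<open>cot \<alpha>\<close> and \<open>cot \<beta>\<close>.\<close>

lemma ex_cot_notin:
  assumes K: "root_closed K" "K \<noteq> UNIV" and N: "negligible N"
  shows "\<exists>z. z \<notin> N \<and> cot z \<notin> K"
proof (rule ccontr)
  assume *: "\<nexists>z. z \<notin> N \<and> cot z \<notin> K"
  then have all: "cot z \<in> K" if "z \<notin> N" for z using that * by blast
  have "y \<in> K" for y
  proof -
    \<comment> \<open>Chosen so that \<open>cot r = y\<close>.\<close>
    define r where "r = pi / 2 - arctan y"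
    have r: "sin r = cos (arctan y)" "cos r = sin (arctan y)"
      by (simp_all add: r_def sin_diff cos_diff)
    have y: "cos r = y * sin r" by (simp add: r sin_arctan cos_arctan)
    have "countable (range (\<lambda>n::int. of_int n * pi :: real))" by auto
    then have Z: "negligible {z::real. sin z = 0}"
      by (rule negligible_subset[OF negligible_iff_null_sets[THEN iffD2, OF null_sets_completionI[OF countable_imp_null_set_lborel]]]) (auto simp: sin_zero_iff_int2)
    define M where "M = N \<union> {z. sin z = 0}"
    have M: "negligible M" using N Z by (simp add: M_def)
    \<comment> \<open>A null set and its translate do not cover \<real>, so some \<open>z\<close>
      has both \<open>z\<close> and \<open>z + r\<close> outside \<open>M\<close>.\<close>
    then have "negligible (M \<union> (+) (- r) ` M)" by (intro negligible_Un negligible_translation)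
    then obtain z where z: "z \<notin> M \<union> (+) (- r) ` M" by (metis UNIV_eq_I non_negligible_UNIV)
    then have z1: "z \<notin> N" "sin z \<noteq> 0" by (auto simp: M_def)
    have "z + r \<notin> M"
    proof
      assume "z + r \<in> M"
      then have "- r + (z + r) \<in> (+) (- r) ` M" by (rule imageI)
      then show False using z by simp
    qed
    then have z2: "z + r \<notin> N" "sin (z + r) \<noteq> 0" by (auto simp: M_def)
    define a b where "a = cot z" and "b = cot (z + r)"
    have ab: "a \<in> K" "b \<in> K" using all z1 z2 by (auto simp: a_def b_def)
    have ca: "cos z = a * sin z" using z1 by (simp add: a_def cot_def)
    have cb: "cos (z + r) = b * sin (z + r)" using z2 by (simp add: b_def cot_def)
    have "sin r \<noteq> 0" using y sin_cos_squared_add[of r] by auto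
    \<comment> \<open>The addition formula \<open>b = (y * a - 1) / (y + a)\<close> for the
      cotangent, cleared of denominators.\<close>
    have "y * sin r * a * sin z - sin r * sin z = b * (sin z * (y * sin r) + a * sin z * sin r)"
      using cb unfolding cos_add sin_add ca y by (simp add: algebra_simps)
    then have "sin r * sin z * (y * a - 1) = sin r * sin z * (b * (y + a))"
      by (simp add: algebra_simps)
    then have "y * a - 1 = b * (y + a)" using \<open>sin r \<noteq> 0\<close> z1 by simp
    then have eq: "(a - b) * y = a * b + 1" by (simp add: algebra_simps)
    have "a - b \<noteq> 0"
    proof
      assume "a - b = 0"
      with eq have "a * a + 1 = 0" by simp
      then show False using zero_le_square[of a] by linarith
    qed
    have "a * b + 1 \<in> K" "0 \<in> K" using ab K(1) by (auto simp: root_closed_def)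
    with root_closed_quadratic_root[OF K(1), of 0 "a - b" "- (a * b + 1)" y] show "y \<in> K"
      using eq \<open>a - b \<noteq> 0\<close> root_closed_diff[OF K(1) ab] root_closed_neg[OF K(1), of "a * b + 1"]
      by simp
  qed
  with K(2) show False by blast
qed

section \<open>Lifts of positive definite matrices\<close>

definition quad_part :: "real \<Rightarrow> real \<Rightarrow> real \<Rightarrow> real \<Rightarrow> real" where
  "quad_part a b d z = a * (cos z)\<^sup>2 + 2 * b * (cos z * sin z) + d * (sin z)\<^sup>2"

definition cross_part :: "real \<Rightarrow> real \<Rightarrow> real \<Rightarrow> real \<Rightarrow> real" where
  "cross_part a b d z = (d - a) * (cos z * sin z) + b * ((cos z)\<^sup>2 - (sin z)\<^sup>2)"

text \<open>The lift to the universal cover \<open>\<real>\<close> of the action of the positive definite matrix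
  \<open>M = (a b; b d)\<close> on rays \<open>e z = (cos z, sin z)\<close>: the two quantities above are the components of
  \<open>M (e z)\<close> along \<open>e z\<close> and along its rotation by \<open>\<pi>/2\<close>.\<close>

definition angle_lift :: "real \<Rightarrow> real \<Rightarrow> real \<Rightarrow> real \<Rightarrow> real" where
  "angle_lift a b d z = z + arctan (cross_part a b d z / quad_part a b d z)"

definition pos_def :: "real \<Rightarrow> real \<Rightarrow> real \<Rightarrow> bool" where
  "pos_def a b d \<longleftrightarrow> a > 0 \<and> a * d - b\<^sup>2 > 0"

text \<open>The squared length of \<open>M (e z)\<close>. The derivative of the lift turns out to be
  the determinant divided by it.\<close>

definition sqnorm_part :: "real \<Rightarrow> real \<Rightarrow> real \<Rightarrow> real \<Rightarrow> real" where
  "sqnorm_part a b d z = (a * cos z + b * sin z)\<^sup>2 + (b * cos z + d * sin z)\<^sup>2"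

text \<open>\<open>(d, - b, a)\<close> is the adjugate, a positive multiple of the inverse matrix,
  so it acts on rays as the inverse.\<close>

lemma pos_def_adj: "pos_def a b d \<Longrightarrow> pos_def d (- b) a"
proof -
  assume *: "pos_def a b d"
  then have "a * d > 0" using zero_le_power2[of b] unfolding pos_def_def by linarith
  then show ?thesis using * by (simp add: pos_def_def zero_less_mult_iff mult.commute)
qed

text \<open>Completing the square. Consequently \<open>M (e z)\<close> is less than a quarter turn
  away from \<open>e z\<close>, which is why \<open>arctan\<close> gives the angle between
  them.\<close>

lemma quad_part_pos:
  assumes "pos_def a b d" shows "quad_part a b d z > 0"
proof -
  have "a * quad_part a b d z = (a * cos z + b * sin z)\<^sup>2 + (a * d - b\<^sup>2) * (sin z)\<^sup>2"
    by (simp add: quad_part_def power2_eq_square algebra_simps)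
  also have "\<dots> > 0"
  proof (cases "sin z = 0")
    case True
    then have "cos z \<noteq> 0" using sin_cos_squared_add[of z] by auto
    then show ?thesis using True assms by (simp add: pos_def_def)
  next
    case False
    then have "(a * d - b\<^sup>2) * (sin z)\<^sup>2 > 0" using assms by (simp add: pos_def_def)
    then show ?thesis by (simp add: add_nonneg_pos)
  qed
  finally show ?thesis using assms by (simp add: pos_def_def zero_less_mult_iff)
qed

text \<open>The adjugate sends \<open>M (e z)\<close> to the determinant times \<open>e z\<close>,
  and its stretch is bounded by its Frobenius norm.\<close>

lemma sqnorm_part_ge:
  "(a * d - b\<^sup>2)\<^sup>2 \<le> (a\<^sup>2 + 2 * b\<^sup>2 + d\<^sup>2) * sqnorm_part a b d z"
proof -
  define p r where "p = a * cos z + b * sin z" and "r = b * cos z + d * sin z"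
  have "(a * d - b\<^sup>2) * cos z = d * p - b * r" "(a * d - b\<^sup>2) * sin z = a * r - b * p"
    by (simp_all add: p_def r_def algebra_simps power2_eq_square)
  moreover have "((a * d - b\<^sup>2) * cos z)\<^sup>2 + ((a * d - b\<^sup>2) * sin z)\<^sup>2 = (a * d - b\<^sup>2)\<^sup>2"
    by (simp add: power_mult_distrib flip: distrib_left)
  ultimately have "(a * d - b\<^sup>2)\<^sup>2 = (d * p - b * r)\<^sup>2 + (a * r - b * p)\<^sup>2" by simp
  also have "\<dots> = (a\<^sup>2 + 2 * b\<^sup>2 + d\<^sup>2) * (p\<^sup>2 + r\<^sup>2) - (d * r + b * p)\<^sup>2 - (a * p + b * r)\<^sup>2"
    by (simp add: power2_eq_square algebra_simps)
  also have "\<dots> \<le> (a\<^sup>2 + 2 * b\<^sup>2 + d\<^sup>2) * (p\<^sup>2 + r\<^sup>2)" by simp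
  finally show ?thesis by (simp add: sqnorm_part_def p_def r_def)
qed

lemma sqnorm_part_lower_bound:
  assumes "pos_def a b d"
  obtains \<delta> where "\<delta> > 0" "\<And>z. sqnorm_part a b d z \<ge> \<delta>"
proof -
  have "a\<^sup>2 + 2 * b\<^sup>2 + d\<^sup>2 > 0"
    using assms by (simp add: pos_def_def add_pos_nonneg)
  then have "(a * d - b\<^sup>2)\<^sup>2 / (a\<^sup>2 + 2 * b\<^sup>2 + d\<^sup>2) \<le> sqnorm_part a b d z" for z
    using sqnorm_part_ge[of a d b z] by (simp add: divide_simps mult.commute)
  moreover have "(a * d - b\<^sup>2)\<^sup>2 / (a\<^sup>2 + 2 * b\<^sup>2 + d\<^sup>2) > 0"
    using assms \<open>a\<^sup>2 + 2 * b\<^sup>2 + d\<^sup>2 > 0\<close> by (auto simp: pos_def_def)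
  ultimately show ?thesis using that by blast
qed

lemma sqnorm_part_pos: "pos_def a b d \<Longrightarrow> sqnorm_part a b d z > 0"
  by (metis sqnorm_part_lower_bound less_le_trans)

lemma brahmagupta_identity:
  fixes u v :: real
  shows "(q * u - c * v)\<^sup>2 + (q * v + c * u)\<^sup>2 = (q\<^sup>2 + c\<^sup>2) * (u\<^sup>2 + v\<^sup>2)"
  by (simp add: power2_eq_square algebra_simps)

text \<open>For \<open>e = (u, v)\<close> and its quarter turn \<open>e'\<close>, the left side is
  the Gram determinant of the form of \<open>M\<close> at \<open>e\<close>, \<open>e'\<close>; the
  second factor is the form at \<open>e'\<close>, which equals the form of the adjugate at
  \<open>e\<close>.\<close>

lemma det_identity:
  fixes u v :: real
  shows "(a * u\<^sup>2 + 2 * b * (u * v) + d * v\<^sup>2) * (d * u\<^sup>2 - 2 * b * (u * v) + a * v\<^sup>2)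
    - ((d - a) * (u * v) + b * (u\<^sup>2 - v\<^sup>2))\<^sup>2 = (a * d - b\<^sup>2) * (u\<^sup>2 + v\<^sup>2)\<^sup>2"
  by (simp add: power2_eq_square algebra_simps)

lemma trig_expand:
  fixes u v :: real
  assumes "u\<^sup>2 + v\<^sup>2 = 1"
  shows "(a * u\<^sup>2 + 2 * b * (u * v) + d * v\<^sup>2) * u - ((d - a) * (u * v) + b * (u\<^sup>2 - v\<^sup>2)) * v = a * u + b * v"
    and "(a * u\<^sup>2 + 2 * b * (u * v) + d * v\<^sup>2) * v + ((d - a) * (u * v) + b * (u\<^sup>2 - v\<^sup>2)) * u = b * u + d * v"
proof -
  have "a * u + b * v = (a * u + b * v) * (u\<^sup>2 + v\<^sup>2)" "b * u + d * v = (b * u + d * v) * (u\<^sup>2 + v\<^sup>2)"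
    using assms by simp_all
  then show "(a * u\<^sup>2 + 2 * b * (u * v) + d * v\<^sup>2) * u - ((d - a) * (u * v) + b * (u\<^sup>2 - v\<^sup>2)) * v = a * u + b * v"
    "(a * u\<^sup>2 + 2 * b * (u * v) + d * v\<^sup>2) * v + ((d - a) * (u * v) + b * (u\<^sup>2 - v\<^sup>2)) * u = b * u + d * v"
    by (simp_all add: power2_eq_square algebra_simps)
qed

lemma quad_cross_sqnorm: "(quad_part a b d z)\<^sup>2 + (cross_part a b d z)\<^sup>2 = sqnorm_part a b d z"
proof -
  define q c where "q = quad_part a b d z" and "c = cross_part a b d z"
  have "sqnorm_part a b d z = (q * cos z - c * sin z)\<^sup>2 + (q * sin z + c * cos z)\<^sup>2"
    using trig_expand[of "cos z" "sin z" a b d]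
    by (simp add: sqnorm_part_def q_def c_def quad_part_def cross_part_def)
  also have "\<dots> = (q\<^sup>2 + c\<^sup>2) * ((cos z)\<^sup>2 + (sin z)\<^sup>2)"
    by (rule brahmagupta_identity)
  finally show ?thesis by (simp add: q_def c_def)
qed

section \<open>The lifts as bijections of the line\<close>

lemma angle_lift_action:
  assumes "pos_def a b d"
  obtains \<rho> where "\<rho> > 0" "a * cos z + b * sin z = \<rho> * cos (angle_lift a b d z)"
    "b * cos z + d * sin z = \<rho> * sin (angle_lift a b d z)"
proof -
  define q c w where "q = quad_part a b d z" and "c = cross_part a b d z" and "w = arctan (c / q)"
  have q: "q > 0" using quad_part_pos[OF assms] by (simp add: q_def)
  have w: "cos w > 0" "sin w = c / q * cos w"
    by (simp_all add: w_def cos_arctan sin_arctan add_pos_nonneg)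
  have 1: "q * cos z - c * sin z = a * cos z + b * sin z" "q * sin z + c * cos z = b * cos z + d * sin z"
    using trig_expand[of "cos z" "sin z" a b d]
    by (simp_all add: q_def c_def quad_part_def cross_part_def)
  have 2: "angle_lift a b d z = z + w" by (simp add: angle_lift_def w_def q_def c_def)
  show ?thesis
  proof
    show "q / cos w > 0" using q w by simp
    show "a * cos z + b * sin z = q / cos w * cos (angle_lift a b d z)"
      "b * cos z + d * sin z = q / cos w * sin (angle_lift a b d z)"
      using q w(1) unfolding 1[symmetric] 2 cos_add sin_add w(2) by (simp_all add: field_simps)
  qed
qed

lemma angle_lift_close: "\<bar>angle_lift a b d z - z\<bar> < pi / 2"
  using arctan_bounded[of "cross_part a b d z / quad_part a b d z"]
  unfolding angle_lift_def by linarith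

lemma ray_eq_imp_eq:
  assumes "\<rho> > 0" "\<sigma> > 0" "\<rho> * cos x = \<sigma> * cos y" "\<rho> * sin x = \<sigma> * sin y" "\<bar>x - y\<bar> < 2 * pi"
  shows "x = y"
proof -
  have "\<rho>\<^sup>2 * ((cos x)\<^sup>2 + (sin x)\<^sup>2) = \<sigma>\<^sup>2 * ((cos y)\<^sup>2 + (sin y)\<^sup>2)"
    unfolding distrib_left power_mult_distrib[symmetric] assms by simp
  then have "\<rho> = \<sigma>" using assms by (simp add: power2_eq_iff)
  then have "cos x = cos y" "sin x = sin y" using assms by simp_all
  then have "cos (x - y) = 1" by (metis cos_diff power2_eq_square sin_cos_squared_add2)
  then obtain n :: int where n: "x - y = of_int n * 2 * pi" using cos_one_2pi_int by blast
  then have "\<bar>of_int n\<bar> * (2 * pi) < 1 * (2 * pi)" using assms(5) by (simp add: abs_mult)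
  then have "\<bar>of_int n :: real\<bar> < 1" by (rule mult_right_less_imp_less) simp
  then have "n = 0" by linarith
  then show ?thesis using n by simp
qed

text \<open>The composite fixes every ray, so it moves \<open>z\<close> by a multiple of
  \<open>2 * pi\<close>; each lift moves points by less than \<open>pi / 2\<close>, so this multiple
  is 0.\<close>

lemma angle_lift_inverse:
  assumes "pos_def a b d"
  shows "angle_lift d (- b) a (angle_lift a b d z) = z"
proof -
  let ?y = "angle_lift a b d z"
  let ?x = "angle_lift d (- b) a ?y"
  obtain \<rho> where \<rho>: "\<rho> > 0" "a * cos z + b * sin z = \<rho> * cos ?y" "b * cos z + d * sin z = \<rho> * sin ?y"
    using angle_lift_action[OF assms] by metis
  obtain \<sigma> where \<sigma>: "\<sigma> > 0" "d * cos ?y - b * sin ?y = \<sigma> * cos ?x" "- b * cos ?y + a * sin ?y = \<sigma> * sin ?x"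
    using angle_lift_action[OF pos_def_adj[OF assms], of ?y] by auto
  have "\<rho> * \<sigma> * cos ?x = d * (\<rho> * cos ?y) - b * (\<rho> * sin ?y)"
    "\<rho> * \<sigma> * sin ?x = - b * (\<rho> * cos ?y) + a * (\<rho> * sin ?y)"
    unfolding mult.assoc \<sigma>(2,3)[symmetric] by (simp_all add: algebra_simps)
  then have eq: "\<rho> * \<sigma> * cos ?x = (a * d - b\<^sup>2) * cos z" "\<rho> * \<sigma> * sin ?x = (a * d - b\<^sup>2) * sin z"
    unfolding \<rho>(2,3)[symmetric] by (simp_all add: algebra_simps power2_eq_square)
  have "\<bar>?x - ?y\<bar> < pi / 2" "\<bar>?y - z\<bar> < pi / 2" by (rule angle_lift_close)+
  then have "\<bar>?x - z\<bar> < 2 * pi" by linarith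
  then show ?thesis
    using ray_eq_imp_eq[OF _ _ eq] \<rho>(1) \<sigma>(1) assms by (simp add: pos_def_def)
qed

lemma bij_angle_lift:
  assumes "pos_def a b d"
  shows "bij (angle_lift a b d)" "inv (angle_lift a b d) = angle_lift d (- b) a"
proof -
  have 1: "angle_lift d (- b) a \<circ> angle_lift a b d = id"
    using angle_lift_inverse[OF assms] by auto
  have 2: "angle_lift a b d \<circ> angle_lift d (- b) a = id"
    using angle_lift_inverse[OF pos_def_adj[OF assms]] by auto
  show "bij (angle_lift a b d)" using 1 2 o_bij by blast
  show "inv (angle_lift a b d) = angle_lift d (- b) a" using 1 2 by (simp add: inv_unique_comp)
qed

section \<open>Bounded derivatives of the lifts\<close>

text \<open>An algebra of bounded functions that is closed under differentiation and contains the
  first derivative of the lift; this bounds all higher derivatives without formulas for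
  them.\<close>

inductive trig_alg :: "real \<Rightarrow> real \<Rightarrow> real \<Rightarrow> (real \<Rightarrow> real) \<Rightarrow> bool" for a b d where
  trig_const: "trig_alg a b d (\<lambda>_. c)"
| trig_sin: "trig_alg a b d sin"
| trig_cos: "trig_alg a b d cos"
| trig_inverse: "trig_alg a b d (\<lambda>z. inverse (sqnorm_part a b d z))"
| trig_add: "trig_alg a b d f \<Longrightarrow> trig_alg a b d g \<Longrightarrow> trig_alg a b d (\<lambda>z. f z + g z)"
| trig_mult: "trig_alg a b d f \<Longrightarrow> trig_alg a b d g \<Longrightarrow> trig_alg a b d (\<lambda>z. f z * g z)"

lemma trig_minus: "trig_alg a b d f \<Longrightarrow> trig_alg a b d (\<lambda>z. - f z)"
  using trig_mult[OF trig_const[of _ _ _ "-1"]] by simp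

lemma trig_diff: "trig_alg a b d f \<Longrightarrow> trig_alg a b d g \<Longrightarrow> trig_alg a b d (\<lambda>z. f z - g z)"
  using trig_add[OF _ trig_minus] by simp

lemma trig_power: "trig_alg a b d f \<Longrightarrow> trig_alg a b d (\<lambda>z. f z ^ n)"
  by (induction n) (auto intro: trig_const trig_mult)

lemmas trig_intros = trig_const trig_sin trig_cos trig_inverse trig_add trig_mult trig_minus
  trig_diff trig_power

lemma trig_alg_deriv:
  assumes "pos_def a b d" "trig_alg a b d f"
  obtains f' where "trig_alg a b d f'" "\<And>z. (f has_real_derivative f' z) (at z)"
proof -
  from assms(2) have "\<exists>f'. trig_alg a b d f' \<and> (\<forall>z. (f has_real_derivative f' z) (at z))"
  proof induction
    case (trig_const c)
    then show ?case by (intro exI[of _ "\<lambda>_. 0"]) (auto intro: trig_intros)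
  next
    case trig_sin
    then show ?case by (intro exI[of _ cos]) (auto intro: trig_intros)
  next
    case trig_cos
    then show ?case by (intro exI[of _ "\<lambda>z. - sin z"]) (auto intro: trig_intros)
  next
    case trig_inverse
    let ?D' = "\<lambda>z. 2 * (a * cos z + b * sin z) * (b * cos z - a * sin z)
      + 2 * (b * cos z + d * sin z) * (d * cos z - b * sin z)"
    have "((\<lambda>z. inverse (sqnorm_part a b d z)) has_real_derivative
        - (?D' z * (inverse (sqnorm_part a b d z))\<^sup>2)) (at z)" for z
      unfolding sqnorm_part_def
      by (rule derivative_eq_intros refl sqnorm_part_pos[OF assms(1), of z, THEN less_imp_neq, THEN not_sym, unfolded sqnorm_part_def])+
        (simp add: power2_eq_square algebra_simps)
    then show ?case by (intro exI[of _ "\<lambda>z. - (?D' z * (inverse (sqnorm_part a b d z))\<^sup>2)"])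
      (auto intro!: trig_intros)
  next
    case (trig_add f g)
    then obtain f' g' where "trig_alg a b d f'" "trig_alg a b d g'"
      "\<And>z. (f has_real_derivative f' z) (at z)" "\<And>z. (g has_real_derivative g' z) (at z)" by blast
    then show ?case by (intro exI[of _ "\<lambda>z. f' z + g' z"]) (auto intro: trig_intros derivative_intros)
  next
    case (trig_mult f g)
    then obtain f' g' where "trig_alg a b d f'" "trig_alg a b d g'"
      "\<And>z. (f has_real_derivative f' z) (at z)" "\<And>z. (g has_real_derivative g' z) (at z)" by blast
    with trig_mult.hyps show ?case
      by (intro exI[of _ "\<lambda>z. f' z * g z + g' z * f z"]) (auto intro!: trig_intros DERIV_mult)
  qed
  then show ?thesis using that by blast
qed

lemma trig_alg_bounded:
  assumes "pos_def a b d" "trig_alg a b d f"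
  shows "bounded (range f)"
proof -
  from assms(2) have "\<exists>B. \<forall>z. \<bar>f z\<bar> \<le> B"
  proof induction
    case (trig_const c)
    show ?case by (intro exI[of _ "\<bar>c\<bar>"]) simp
  next
    case trig_sin
    show ?case by (intro exI[of _ 1]) simp
  next
    case trig_cos
    show ?case by (intro exI[of _ 1]) simp
  next
    case trig_inverse
    obtain \<delta> where "\<delta> > 0" "\<And>z. sqnorm_part a b d z \<ge> \<delta>"
      using sqnorm_part_lower_bound[OF assms(1)] by blast
    then show ?case
      by (intro exI[of _ "inverse \<delta>"]) (metis abs_inverse abs_of_pos le_imp_inverse_le less_le_trans)
  next
    case (trig_add f g)
    then obtain B C where "\<And>z. \<bar>f z\<bar> \<le> B" "\<And>z. \<bar>g z\<bar> \<le> C" by blast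
    then show ?case by (intro exI[of _ "B + C"]) (meson abs_triangle_ineq add_mono order_trans)
  next
    case (trig_mult f g)
    then obtain B C where B: "\<And>z. \<bar>f z\<bar> \<le> B" "\<And>z. \<bar>g z\<bar> \<le> C" by blast
    then have "B \<ge> 0" using abs_ge_zero order_trans by blast
    then show ?case using B by (intro exI[of _ "B * C"]) (auto simp: abs_mult intro!: mult_mono)
  qed
  then show ?thesis by (auto simp: bounded_iff)
qed

lemma trig_alg_funpow_deriv:
  assumes "pos_def a b d" "trig_alg a b d f"
  shows "trig_alg a b d ((deriv ^^ k) f)"
proof (induction k)
  case (Suc k)
  obtain f' where "trig_alg a b d f'" "\<And>z. ((deriv ^^ k) f has_real_derivative f' z) (at z)"
    using trig_alg_deriv[OF assms(1) Suc] by blast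
  moreover from this have "deriv ((deriv ^^ k) f) = f'" by (auto intro: DERIV_imp_deriv)
  ultimately show ?case by simp
qed (use assms in simp)

lemma angle_lift_deriv:
  assumes "pos_def a b d"
  shows "(angle_lift a b d has_real_derivative (a * d - b\<^sup>2) * inverse (sqnorm_part a b d z)) (at z)"
proof -
  let ?q = "quad_part a b d z" and ?c = "cross_part a b d z"
  define c' where "c' = (d - a) * ((cos z)\<^sup>2 - (sin z)\<^sup>2) - 4 * b * (cos z * sin z)"
  have q: "?q > 0" by (rule quad_part_pos[OF assms])
  have dq: "(quad_part a b d has_real_derivative 2 * ?c) (at z)"
    unfolding quad_part_def cross_part_def
    by (rule derivative_eq_intros refl)+ (simp add: power2_eq_square algebra_simps)
  have dc: "(cross_part a b d has_real_derivative c') (at z)"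
    unfolding cross_part_def c'_def
    by (rule derivative_eq_intros refl)+ (simp add: power2_eq_square algebra_simps)
  \<comment> \<open>The numerator of the derivative over \<open>?q\<^sup>2 + ?c\<^sup>2\<close>.
    Since \<open>?q + c'\<close> is the form of the adjugate at \<open>e z\<close>,
    \<open>det_identity\<close> evaluates it.\<close>
  have "?q\<^sup>2 + c' * ?q - ?c\<^sup>2 = (a * d - b\<^sup>2) * ((cos z)\<^sup>2 + (sin z)\<^sup>2)\<^sup>2"
  proof -
    have "?q + c' = d * (cos z)\<^sup>2 - 2 * b * (cos z * sin z) + a * (sin z)\<^sup>2"
      by (simp add: quad_part_def c'_def algebra_simps)
    moreover have "?q\<^sup>2 + c' * ?q - ?c\<^sup>2 = ?q * (?q + c') - ?c\<^sup>2" by (simp add: power2_eq_square algebra_simps)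
    ultimately show ?thesis
      using det_identity[of a "cos z" b "sin z" d] by (simp only: quad_part_def cross_part_def)
  qed
  then have key: "?q\<^sup>2 + c' * ?q - ?c\<^sup>2 = a * d - b\<^sup>2" by simp
  have "(angle_lift a b d has_real_derivative
      1 + inverse (1 + (?c / ?q)\<^sup>2) * ((c' * ?q - ?c * (2 * ?c)) / (?q * ?q))) (at z)"
    unfolding angle_lift_def
    using q by (intro DERIV_add DERIV_ident DERIV_chain2[OF DERIV_arctan] DERIV_divide dq dc) simp
  moreover have "1 + inverse (1 + (?c / ?q)\<^sup>2) * ((c' * ?q - ?c * (2 * ?c)) / (?q * ?q))
      = (?q\<^sup>2 + c' * ?q - ?c\<^sup>2) * inverse (?q\<^sup>2 + ?c\<^sup>2)"
  proof -
    have nz: "?q\<^sup>2 + ?c\<^sup>2 \<noteq> 0" using q by (simp add: sum_power2_eq_zero_iff)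
    have "1 + (?c / ?q)\<^sup>2 = (?q\<^sup>2 + ?c\<^sup>2) / ?q\<^sup>2"
      using q by (simp add: field_simps)
    then have "1 + inverse (1 + (?c / ?q)\<^sup>2) * ((c' * ?q - ?c * (2 * ?c)) / (?q * ?q))
      = 1 + (c' * ?q - 2 * ?c\<^sup>2) / (?q\<^sup>2 + ?c\<^sup>2)"
      using q by (simp add: power2_eq_square)
    also have "\<dots> = (?q\<^sup>2 + c' * ?q - ?c\<^sup>2) / (?q\<^sup>2 + ?c\<^sup>2)"
      using nz by (simp add: field_simps)
    finally show ?thesis by (simp add: divide_inverse)
  qed
  ultimately show ?thesis by (simp add: key quad_cross_sqnorm)
qed

lemma angle_lift_derivs:
  assumes "pos_def a b d"
  shows "smooth_real (angle_lift a b d)" "k \<ge> 1 \<Longrightarrow> bounded (range ((deriv ^^ k) (angle_lift a b d)))"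
proof -
  have "deriv (angle_lift a b d) = (\<lambda>z. (a * d - b\<^sup>2) * inverse (sqnorm_part a b d z))"
    using angle_lift_deriv[OF assms] by (auto intro: DERIV_imp_deriv)
  then have "trig_alg a b d (deriv (angle_lift a b d))" by (auto intro: trig_intros)
  then have T: "trig_alg a b d ((deriv ^^ Suc k) (angle_lift a b d))" for k
    using trig_alg_funpow_deriv[OF assms] by (simp add: funpow_Suc_right del: funpow.simps)
  show "smooth_real (angle_lift a b d)"
    unfolding smooth_real_def
  proof (intro allI)
    fix k x
    show "(deriv ^^ k) (angle_lift a b d) differentiable at x"
    proof (cases k)
      case 0
      then show ?thesis using angle_lift_deriv[OF assms] real_differentiable_def by auto
    next
      case (Suc n)
      then show ?thesis using trig_alg_deriv[OF assms T[of n]] real_differentiable_def by metis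
    qed
  qed
  show "bounded (range ((deriv ^^ k) (angle_lift a b d)))" if "k \<ge> 1"
    using trig_alg_bounded[OF assms T[of "k - 1"]] that by simp
qed

lemma angle_lift_in_Dinf_Lip:
  assumes "pos_def a b d" shows "angle_lift a b d \<in> Dinf_Lip"
proof -
  have "(a * d - b\<^sup>2) * inverse (sqnorm_part a b d z) > 0" for z
    using assms sqnorm_part_pos[OF assms] by (simp add: pos_def_def)
  then have "strict_mono (angle_lift a b d)"
    using angle_lift_deriv[OF assms] DERIV_pos_imp_increasing strict_monoI by metis
  then show ?thesis
    using bij_angle_lift[OF assms] angle_lift_derivs[OF assms] angle_lift_derivs[OF pos_def_adj[OF assms]]
    by (simp add: Dinf_Lip_def)
qed

lemma negligible_angle_lift_vimage:
  assumes "pos_def a b d" "negligible N" shows "negligible (angle_lift a b d -` N)"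
proof -
  have "angle_lift a b d -` N = angle_lift d (- b) a ` N"
    using bij_vimage_eq_inv_image[OF bij_angle_lift(1)[OF assms(1)]] bij_angle_lift(2)[OF assms(1)] by simp
  moreover have "angle_lift d (- b) a differentiable_on N"
    using angle_lift_deriv[OF pos_def_adj[OF assms(1)]]
    by (meson differentiable_at_withinI differentiable_on_def real_differentiable_def)
  ultimately show ?thesis
    using negligible_differentiable_image_negligible[OF order_refl assms(2)] by simp
qed

section \<open>Words of matrices\<close>

lemma one_plus_square_nonzero: "1 + (s::real)\<^sup>2 \<noteq> 0"
  by (metis add_pos_nonneg less_irrefl zero_le_power2 zero_less_one)

definition det2 :: "real \<times> real \<Rightarrow> real \<times> real \<Rightarrow> real" where
  "det2 v w = fst v * snd w - snd v * fst w"

text \<open>Undoing a stretch along \<open>(s, 1)\<close> is, up to a scalar, the same stretch along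
  the orthogonal direction, so one formula serves a letter and its inverse.\<close>

definition stretch_axis :: "real \<Rightarrow> bool \<Rightarrow> real \<times> real" where
  "stretch_axis s e = (if e then (s, 1) else (1, - s))"

text \<open>\<open>letter s t True\<close> stretches the line spanned by \<open>(s, 1)\<close> by the factor \<open>t\<close> and fixes its
  orthogonal complement; \<open>letter s t False\<close> is a scalar multiple of the inverse. Both are scaled by
  \<open>1 + s\<^sup>2\<close> so that the entries are polynomials.\<close>

definition letter :: "real \<Rightarrow> real \<Rightarrow> bool \<Rightarrow> real \<times> real \<Rightarrow> real \<times> real" where
  "letter s t e v = (t * (stretch_axis s e \<bullet> v)) *\<^sub>R stretch_axis s e + (stretch_axis s (\<not> e) \<bullet> v) *\<^sub>R stretch_axis s (\<not> e)"

definition word_act :: "('i \<Rightarrow> real) \<Rightarrow> ('i \<Rightarrow> real) \<Rightarrow> ('i \<times> bool) list \<Rightarrow> real \<times> real \<Rightarrow> real \<times> real" where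
  "word_act s t w v = foldr (\<lambda>(i, e). letter (s i) (t i) e) w v"

abbreviation reduced :: "('i \<times> bool) list \<Rightarrow> bool" where
  "reduced \<equiv> successively (\<lambda>l m. fst l = fst m \<longrightarrow> snd l = snd m)"

lemma word_act_Nil [simp]: "word_act s t [] v = v"
  and word_act_Cons [simp]: "word_act s t ((i, e) # w) v = letter (s i) (t i) e (word_act s t w v)"
  by (simp_all add: word_act_def)

lemma letter_linear: "letter s t e (x *\<^sub>R v + y *\<^sub>R w) = x *\<^sub>R letter s t e v + y *\<^sub>R letter s t e w"
  by (simp add: letter_def inner_prod_def prod_eq_iff algebra_simps)

lemma word_act_linear:
  "word_act s t w (x *\<^sub>R v + y *\<^sub>R v') = x *\<^sub>R word_act s t w v + y *\<^sub>R word_act s t w v'"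
  by (induction w) (auto simp: letter_linear)

lemma word_act_basis: "word_act s t w (x, y) = x *\<^sub>R word_act s t w (1, 0) + y *\<^sub>R word_act s t w (0, 1)"
  using word_act_linear[of s t w x "(1, 0)" y "(0, 1)"] by simp

lemma det2_letter: "det2 (letter s t e v) (letter s t e v') = t * (1 + s\<^sup>2)\<^sup>2 * det2 v v'"
  by (cases e) (simp_all add: letter_def det2_def inner_prod_def stretch_axis_def power2_eq_square algebra_simps)

lemma det2_word_act:
  assumes "\<And>i. t i > 0"
  obtains D where "D \<noteq> 0" "\<And>v v'. det2 (word_act s t w v) (word_act s t w v') = D * det2 v v'"
proof -
  have "\<exists>D. D \<noteq> 0 \<and> (\<forall>v v'. det2 (word_act s t w v) (word_act s t w v') = D * det2 v v')"
  proof (induction w)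
    case (Cons l w)
    obtain i e where l: "l = (i, e)" by (cases l)
    from Cons obtain D where "D \<noteq> 0" "\<forall>v v'. det2 (word_act s t w v) (word_act s t w v') = D * det2 v v'"
      by blast
    moreover have "1 + (s i)\<^sup>2 \<noteq> 0" by (rule one_plus_square_nonzero)
    ultimately show ?case
      using assms[of i] by (intro exI[of _ "t i * (1 + (s i)\<^sup>2)\<^sup>2 * D"]) (simp add: l det2_letter)
  qed (auto intro: exI[of _ 1])
  then show ?thesis using that by blast
qed

lemma word_act_nonzero:
  assumes "\<And>i. t i > 0" "v \<noteq> 0" shows "word_act s t w v \<noteq> 0"
proof
  assume 0: "word_act s t w v = 0"
  obtain D where D: "D \<noteq> 0" "\<And>v v'. det2 (word_act s t w v) (word_act s t w v') = D * det2 v v'"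
    using det2_word_act assms(1) by blast
  have "D * det2 v v' = 0" for v' unfolding D(2)[symmetric] 0 by (simp add: det2_def)
  then have "det2 v v' = 0" for v' using D(1) by simp
  from this[of "(1, 0)"] this[of "(0, 1)"] have "v = 0" by (simp add: det2_def prod_eq_iff)
  with assms(2) show False ..
qed

lemma root_closedD:
  assumes "root_closed K"
  shows "0 \<in> K" "1 \<in> K" "x \<in> K \<Longrightarrow> y \<in> K \<Longrightarrow> x + y \<in> K" "x \<in> K \<Longrightarrow> y \<in> K \<Longrightarrow> x * y \<in> K"
    "x \<in> K \<Longrightarrow> - x \<in> K" "x \<in> K \<Longrightarrow> y \<in> K \<Longrightarrow> x - y \<in> K"
  using assms root_closed_neg root_closed_diff by (auto simp: root_closed_def)

lemma stretch_axis_in: "root_closed K \<Longrightarrow> s \<in> K \<Longrightarrow> stretch_axis s e \<in> K \<times> K"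
  by (simp add: stretch_axis_def root_closedD)

lemma inner_in: "root_closed K \<Longrightarrow> v \<in> K \<times> K \<Longrightarrow> w \<in> K \<times> K \<Longrightarrow> v \<bullet> w \<in> K"
  by (auto simp: inner_prod_def root_closedD)

lemma letter_in:
  assumes "root_closed K" "s \<in> K" "t \<in> K" "v \<in> K \<times> K"
  shows "letter s t e v \<in> K \<times> K"
  using assms stretch_axis_in[OF assms(1,2)] inner_in[OF assms(1) stretch_axis_in[OF assms(1,2)] assms(4)]
  by (auto simp: letter_def mem_Times_iff root_closedD)

lemma word_act_in:
  assumes "root_closed K" "fst ` set w \<subseteq> {i. s i \<in> K \<and> t i \<in> K}" "v \<in> K \<times> K"
  shows "word_act s t w v \<in> K \<times> K"
  using assms(2)
proof (induction w)
  case Nil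
  then show ?case using assms(3) by simp
next
  case (Cons l w)
  obtain i e where "l = (i, e)" by (cases l)
  with Cons show ?case by (auto simp: assms(1) intro: letter_in)
qed

lemma coeff_combination_in:
  assumes "root_closed K" "\<And>i. coeff p i \<in> K" "\<And>i. coeff q i \<in> K" "x \<in> K" "y \<in> K"
  shows "coeff (smult x p + smult y q) i \<in> K"
  using assms by (simp add: root_closedD)

section \<open>Leading coefficients of words\<close>

text \<open>This factor enters the leading coefficient at each further \<open>g\<close>. It is a
  quadratic in \<open>s0\<close> over \<open>K\<close> whose leading or constant coefficient is, up
  to sign, an entry of the first column of the matrix of \<open>A\<close>; for empty
  \<open>A\<close> the axes agree and it is \<open>1 + s0\<^sup>2\<close>.\<close>

lemma inner_stretch_axis_word_act_nonzero:
  assumes K: "root_closed K" and s: "s0 \<notin> K"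
    and A: "fst ` set A \<subseteq> {i. s i \<in> K \<and> t i \<in> K}"
    and nz: "A \<noteq> [] \<Longrightarrow> fst (word_act s t A (1, 0)) \<noteq> 0 \<and> snd (word_act s t A (1, 0)) \<noteq> 0"
    and ef: "A = [] \<Longrightarrow> f = e"
  shows "stretch_axis s0 f \<bullet> word_act s t A (stretch_axis s0 e) \<noteq> 0"
proof (cases "A = []")
  case True
  have "1 + s0\<^sup>2 \<noteq> 0" by (rule one_plus_square_nonzero)
  then show ?thesis using True ef by (auto simp: inner_prod_def stretch_axis_def power2_eq_square add.commute)
next
  case False
  obtain a c where ac: "word_act s t A (1, 0) = (a, c)" by (meson surj_pair)
  obtain b d where bd: "word_act s t A (0, 1) = (b, d)" by (meson surj_pair)
  have in_K: "a \<in> K" "b \<in> K" "c \<in> K" "d \<in> K"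
    using word_act_in[OF K A, where v = "(1, 0)"] word_act_in[OF K A, where v = "(0, 1)"] root_closedD[OF K] ac bd
    by auto
  have nz': "a \<noteq> 0" "c \<noteq> 0" using nz[OF False] ac by auto
  have quad: "x * s0\<^sup>2 + y * s0 + z \<noteq> 0" if "x \<in> K" "y \<in> K" "z \<in> K" "x \<noteq> 0 \<or> z \<noteq> 0" for x y z
  proof
    assume *: "x * s0\<^sup>2 + y * s0 + z = 0"
    have "x \<noteq> 0 \<or> y \<noteq> 0" using * that(4) by auto
    then show False using root_closed_quadratic_root[OF K that(1-3) _ *] s by blast
  qed
  have "a * s0\<^sup>2 + (b + c) * s0 + d \<noteq> 0" "(- b) * s0\<^sup>2 + (a - d) * s0 + c \<noteq> 0"
    "(- c) * s0\<^sup>2 + (a - d) * s0 + b \<noteq> 0" "d * s0\<^sup>2 + (- (b + c)) * s0 + a \<noteq> 0"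
    by (intro quad; use in_K nz' root_closedD(3,5,6)[OF K] in simp)+
  moreover have "word_act s t A (x, y) = (x * a + y * b, x * c + y * d)" for x y
    by (subst word_act_basis) (simp add: ac bd)
  ultimately show ?thesis
    by (cases e; cases f) (simp_all add: inner_prod_def stretch_axis_def power2_eq_square algebra_simps)
qed

text \<open>The determinant is linear in \<open>s0\<close> over \<open>K\<close>, so its vanishing
  would make \<open>q\<close> parallel to both columns of the invertible matrix of
  \<open>A\<close>.\<close>

lemma det2_word_act_stretch_axis_nonzero:
  assumes K: "root_closed K" and s: "s0 \<notin> K" and t: "\<And>i. t i > 0"
    and A: "fst ` set A \<subseteq> {i. s i \<in> K \<and> t i \<in> K}" and q: "q \<in> K \<times> K" "q \<noteq> 0"
  shows "det2 (word_act s t A (stretch_axis s0 e)) q \<noteq> 0"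
proof
  assume 0: "det2 (word_act s t A (stretch_axis s0 e)) q = 0"
  obtain D where D: "D \<noteq> 0" "\<And>v v'. det2 (word_act s t A v) (word_act s t A v') = D * det2 v v'"
    using det2_word_act t by blast
  define x y where "x = det2 (word_act s t A (1, 0)) q" and "y = det2 (word_act s t A (0, 1)) q"
  have basis_in: "word_act s t A (1, 0) \<in> K \<times> K" "word_act s t A (0, 1) \<in> K \<times> K"
    using word_act_in[OF K A] root_closedD[OF K] by simp_all
  then have xy: "x \<in> K" "y \<in> K"
    using q(1) root_closedD[OF K] by (auto simp: x_def y_def det2_def mem_Times_iff)
  have lin: "det2 (word_act s t A (u, v)) q = u * x + v * y" for u v
    unfolding word_act_basis[of s t A u v] x_def y_def by (simp add: det2_def algebra_simps)
  have "x = 0 \<and> y = 0"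
  proof (rule ccontr)
    assume nz: "\<not> (x = 0 \<and> y = 0)"
    show False
    proof (cases e)
      case True
      then have eq: "0 * s0\<^sup>2 + x * s0 + y = 0" using 0 lin by (simp add: stretch_axis_def mult.commute)
      then have "x \<noteq> 0" using nz by auto
      then show False using root_closed_quadratic_root[OF K root_closedD(1)[OF K] xy _ eq] s by blast
    next
      case False
      then have eq: "0 * s0\<^sup>2 + (- y) * s0 + x = 0" using 0 lin by (simp add: stretch_axis_def mult.commute)
      then have "y \<noteq> 0" using nz by auto
      then show False using root_closed_quadratic_root[OF K root_closedD(1)[OF K] root_closedD(5)[OF K xy(2)] xy(1) _ eq] s
        by auto
    qed
  qed
  \<comment> \<open>Cramer's rule for \<open>q\<close> in the basis of the two columns.\<close>
  moreover have "D *\<^sub>R q = x *\<^sub>R word_act s t A (0, 1) - y *\<^sub>R word_act s t A (1, 0)"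
  proof -
    have D': "D = det2 (word_act s t A (1, 0)) (word_act s t A (0, 1))"
      using D(2)[of "(1, 0)" "(0, 1)"] by (simp add: det2_def)
    show ?thesis
      by (simp add: D' x_def y_def det2_def prod_eq_iff algebra_simps)
  qed
  ultimately have "D *\<^sub>R q = 0" by auto
  then show False using D(1) q(2) by simp
qed

text \<open>For a word \<open>w\<close> whose largest index is \<open>g\<close>, the vector \<open>M\<^sub>w p\<close> is a polynomial in \<open>t g\<close>.
  Each occurrence of \<open>g\<close> raises the degree by one and projects the leading coefficient to an axis
  of \<open>s g\<close>, so that this coefficient is an explicit nonzero multiple of the image of an axis under
  the prefix \<open>A\<close> of \<open>w\<close> before its first \<open>g\<close>.\<close>

lemma word_act_leading_term:
  assumes K: "root_closed K" "root_closed K'" "K \<subseteq> K'"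
    and g: "s g \<notin> K" "s g \<in> K'" "g \<notin> J" and J: "J \<subseteq> {i. s i \<in> K \<and> t i \<in> K}" and t: "\<And>i. t i > 0"
    and IH: "\<And>A. A \<noteq> [] \<Longrightarrow> reduced A \<Longrightarrow> fst ` set A \<subseteq> J \<Longrightarrow>
      fst (word_act s t A (1, 0)) \<noteq> 0 \<and> snd (word_act s t A (1, 0)) \<noteq> 0"
    and p: "p \<in> K \<times> K" "p \<noteq> 0"
    and w: "reduced w" "fst ` set w \<subseteq> insert g J" "g \<in> fst ` set w"
  shows "\<exists>X Y k c e A w'. (\<forall>i. coeff X i \<in> K' \<and> coeff Y i \<in> K') \<and> degree X \<le> k \<and> degree Y \<le> k \<and>
    word_act s t w p = (poly X (t g), poly Y (t g)) \<and> c \<noteq> 0 \<and>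
    (coeff X k, coeff Y k) = c *\<^sub>R word_act s t A (stretch_axis (s g) e) \<and>
    fst ` set A \<subseteq> J \<and> w = A @ (g, e) # w'"
  using w
proof (induction w)
  case Nil
  then show ?case by simp
next
  case (Cons l w)
  obtain i f where l: "l = (i, f)" by (cases l)
  obtain u1 u2 where u: "stretch_axis (s g) f = (u1, u2)" by (meson surj_pair)
  obtain n1 n2 where n: "stretch_axis (s g) (\<not> f) = (n1, n2)" by (meson surj_pair)
  have un: "u1 \<in> K'" "u2 \<in> K'" "n1 \<in> K'" "n2 \<in> K'"
    using stretch_axis_in[OF K(2) g(2), of f] stretch_axis_in[OF K(2) g(2), of "\<not> f"] u n by auto
  show ?case
  proof (cases "g \<in> fst ` set w")
    case False
    then have ig: "i = g" using Cons.prems(3) l by auto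
    define v where "v = word_act s t w p"
    have wJ: "fst ` set w \<subseteq> {i. s i \<in> K \<and> t i \<in> K}" 
    proof -
      have "fst ` set w \<subseteq> insert g J" using Cons.prems(2) by simp
      then show ?thesis using False J by blast
    qed
    have v: "v \<in> K \<times> K" "v \<noteq> 0"
      unfolding v_def using word_act_in[OF K(1) wJ p(1)] word_act_nonzero[of t p s w] t p(2) by simp_all
    define x y where "x = stretch_axis (s g) f \<bullet> v" and "y = stretch_axis (s g) (\<not> f) \<bullet> v"
    have "v \<in> K' \<times> K'" using v(1) K(3) by auto
    then have xy: "x \<in> K'" "y \<in> K'"
      unfolding x_def y_def using inner_in[OF K(2)] stretch_axis_in[OF K(2) g(2)] by auto
    have "x \<noteq> 0"
    proof -
      \<comment> \<open>\<open>v\<close> after a quarter turn, so that the inner product with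
        \<open>v\<close> becomes \<open>det2\<close> with \<open>v'\<close>.\<close>
      define v' where "v' = (- snd v, fst v)"
      have "v' \<in> K \<times> K" "v' \<noteq> 0"
        using v root_closedD[OF K(1)] by (auto simp: v'_def mem_Times_iff prod_eq_iff)
      then have "det2 (stretch_axis (s g) f) v' \<noteq> 0"
        using det2_word_act_stretch_axis_nonzero[OF K(1) g(1) t, of "[]"] by simp
      then show ?thesis by (simp add: x_def v'_def det2_def inner_prod_def)
    qed
    define X Y where "X = [:y * n1, x * u1:]" and "Y = [:y * n2, x * u2:]"
    have "word_act s t (l # w) p = (poly X (t g), poly Y (t g))"
      by (simp add: l ig letter_def u n X_def Y_def x_def y_def v_def)
    moreover have "coeff X i \<in> K' \<and> coeff Y i \<in> K'" for i
      using xy un root_closedD[OF K(2)] by (auto simp: X_def Y_def coeff_pCons split: nat.splits)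
    moreover have "degree X \<le> 1" "degree Y \<le> 1" by (simp_all add: X_def Y_def)
    moreover have "(coeff X 1, coeff Y 1) = x *\<^sub>R word_act s t [] (stretch_axis (s g) f)"
      by (simp add: X_def Y_def u)
    moreover have "l # w = [] @ (g, f) # w" by (simp add: l ig)
    moreover have "fst ` set ([] :: ('a \<times> bool) list) \<subseteq> J" by simp
    ultimately show ?thesis using \<open>x \<noteq> 0\<close> by blast
  next
    case True
    have "reduced w" "fst ` set w \<subseteq> insert g J" using Cons.prems by (auto simp: successively_Cons)
    with Cons.IH True obtain X Y k c e A w' where
      XY: "\<And>i. coeff X i \<in> K'" "\<And>i. coeff Y i \<in> K'" and deg: "degree X \<le> k" "degree Y \<le> k" and
      val: "word_act s t w p = (poly X (t g), poly Y (t g))" and c: "c \<noteq> 0" and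
      lead: "(coeff X k, coeff Y k) = c *\<^sub>R word_act s t A (stretch_axis (s g) e)" and
      AJ: "fst ` set A \<subseteq> J" and w: "w = A @ (g, e) # w'"
      by blast
    have A: "fst ` set A \<subseteq> {i. s i \<in> K \<and> t i \<in> K}" using AJ J by blast
    show ?thesis
    proof (cases "i = g")
      case True
      \<comment> \<open>The inner products with the two axes. Only the \<open>S\<close> part is
        multiplied by \<open>t g\<close>, here \<open>pCons 0\<close>, so it alone reaches degree
        \<open>Suc k\<close>.\<close>
      define S T where "S = smult u1 X + smult u2 Y" and "T = smult n1 X + smult n2 Y"
      define X' Y' where "X' = pCons 0 (smult u1 S) + smult n1 T" and "Y' = pCons 0 (smult u2 S) + smult n2 T"
      have redA: "reduced A" using \<open>reduced w\<close> by (simp add: w successively_append_iff)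
      \<comment> \<open>With \<open>A\<close> empty, two letters of index \<open>g\<close> are
        adjacent, and the word is reduced.\<close>
      have "A = [] \<Longrightarrow> f = e" using Cons.prems(1) by (auto simp: w l True)
      moreover have "A \<noteq> [] \<Longrightarrow> fst (word_act s t A (1, 0)) \<noteq> 0 \<and> snd (word_act s t A (1, 0)) \<noteq> 0"
        using IH redA AJ by blast
      ultimately have nz: "stretch_axis (s g) f \<bullet> word_act s t A (stretch_axis (s g) e) \<noteq> 0"
        using inner_stretch_axis_word_act_nonzero[OF K(1) g(1) A] by blast
      define c' where "c' = c * (stretch_axis (s g) f \<bullet> word_act s t A (stretch_axis (s g) e))"
      have S: "coeff S k = c'"
        using lead by (simp add: S_def c'_def inner_prod_def u prod_eq_iff algebra_simps)
      have ST: "coeff S i \<in> K'" "coeff T i \<in> K'" for i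
        using coeff_combination_in[OF K(2) XY] un by (simp_all add: S_def T_def)
      have "coeff X' i \<in> K' \<and> coeff Y' i \<in> K'" for i
        using ST un root_closedD[OF K(2)] by (auto simp: X'_def Y'_def coeff_pCons split: nat.splits)
      moreover have degST: "degree S \<le> k" "degree T \<le> k"
        using deg by (auto simp: S_def T_def intro!: degree_add_le order_trans[OF degree_smult_le])
      then have "degree X' \<le> Suc k" "degree Y' \<le> Suc k"
        by (auto simp: X'_def Y'_def intro!: degree_add_le order_trans[OF degree_pCons_le]
            order_trans[OF degree_smult_le])
      moreover have "word_act s t (l # w) p = (poly X' (t g), poly Y' (t g))"
        by (simp add: l True val letter_def inner_prod_def u n X'_def Y'_def S_def T_def algebra_simps)
      moreover have "c' \<noteq> 0" using c nz by (simp add: c'_def)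
      moreover have "coeff T (Suc k) = 0" using degST by (simp add: coeff_eq_0)
      then have "(coeff X' (Suc k), coeff Y' (Suc k)) = c' *\<^sub>R word_act s t [] (stretch_axis (s g) f)"
        by (simp add: X'_def Y'_def S u)
      moreover have "l # w = [] @ (g, f) # w" by (simp add: l True)
      moreover have "fst ` set ([] :: ('a \<times> bool) list) \<subseteq> J" by simp
      ultimately show ?thesis by blast
    next
      case False
      then have iJ: "i \<in> J" using Cons.prems(2) l by auto
      obtain a1 a2 where a: "letter (s i) (t i) f (1, 0) = (a1, a2)" by (meson surj_pair)
      obtain b1 b2 where b: "letter (s i) (t i) f (0, 1) = (b1, b2)" by (meson surj_pair)
      have lin: "letter (s i) (t i) f (x, y) = (a1 * x + b1 * y, a2 * x + b2 * y)" for x y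
        using letter_linear[of "s i" "t i" f x "(1, 0)" y "(0, 1)"] a b by (simp add: mult.commute)
      define X' Y' where "X' = smult a1 X + smult b1 Y" and "Y' = smult a2 X + smult b2 Y"
      have "s i \<in> K" "t i \<in> K" using J iJ by auto
      then have ab: "a1 \<in> K'" "a2 \<in> K'" "b1 \<in> K'" "b2 \<in> K'"
        using letter_in[OF K(1), of "s i" "t i" "(1, 0)" f] letter_in[OF K(1), of "s i" "t i" "(0, 1)" f]
          root_closedD(1,2)[OF K(1)] a b K(3) by auto
      have "coeff X' i \<in> K' \<and> coeff Y' i \<in> K'" for i
        using coeff_combination_in[OF K(2) XY] ab by (simp add: X'_def Y'_def)
      moreover have "degree X' \<le> k" "degree Y' \<le> k"
        using deg by (auto simp: X'_def Y'_def intro!: degree_add_le order_trans[OF degree_smult_le])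
      moreover have "word_act s t (l # w) p = (poly X' (t g), poly Y' (t g))"
        by (simp add: l val lin X'_def Y'_def)
      moreover have "(coeff X' k, coeff Y' k) = c *\<^sub>R word_act s t (l # A) (stretch_axis (s g) e)"
      proof -
        have "(coeff X' k, coeff Y' k) = letter (s i) (t i) f (coeff X k, coeff Y k)"
          by (simp add: X'_def Y'_def lin)
        also have "\<dots> = c *\<^sub>R letter (s i) (t i) f (word_act s t A (stretch_axis (s g) e))"
          unfolding lead using letter_linear[of "s i" "t i" f c _ 0 0] by simp
        finally show ?thesis by (simp add: l)
      qed
      moreover have "l # w = (l # A) @ (g, e) # w'" by (simp add: w)
      moreover have "fst ` set (l # A) \<subseteq> J" using AJ iJ l by simp
      ultimately show ?thesis using c by blast
    qed
  qed
qed

text \<open>As a function of \<open>t g\<close> this determinant is a polynomial over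
  \<open>K'\<close>, nonzero by \<open>det2_word_act_stretch_axis_nonzero\<close>, and
  \<open>t g\<close> is a root of no such polynomial.\<close>

lemma word_act_not_parallel:
  assumes K: "root_closed K" "root_closed K'" "K \<subseteq> K'"
    and g: "s g \<notin> K" "s g \<in> K'" "g \<notin> J" "t g \<notin> K'"
    and J: "J \<subseteq> {i. s i \<in> K \<and> t i \<in> K}" and t: "\<And>i. t i > 0"
    and IH: "\<And>A. A \<noteq> [] \<Longrightarrow> reduced A \<Longrightarrow> fst ` set A \<subseteq> J \<Longrightarrow>
      fst (word_act s t A (1, 0)) \<noteq> 0 \<and> snd (word_act s t A (1, 0)) \<noteq> 0"
    and p: "p \<in> K \<times> K" "p \<noteq> 0" and q: "q \<in> K \<times> K" "q \<noteq> 0"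
    and w: "reduced w" "fst ` set w \<subseteq> insert g J" "g \<in> fst ` set w"
  shows "det2 (word_act s t w p) q \<noteq> 0"
proof
  assume 0: "det2 (word_act s t w p) q = 0"
  obtain X Y k c e A w' where
    XY: "\<And>i. coeff X i \<in> K'" "\<And>i. coeff Y i \<in> K'" and
    val: "word_act s t w p = (poly X (t g), poly Y (t g))" and c: "c \<noteq> 0" and
    lead: "(coeff X k, coeff Y k) = c *\<^sub>R word_act s t A (stretch_axis (s g) e)" and
    AJ: "fst ` set A \<subseteq> J"
    using word_act_leading_term[of K K' s g J t p w] K g J t IH p w by blast
  have A: "fst ` set A \<subseteq> {i. s i \<in> K \<and> t i \<in> K}" using AJ J by blast
  define P where "P = smult (snd q) X + smult (- fst q) Y"
  have "coeff P k = c * det2 (word_act s t A (stretch_axis (s g) e)) q"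
    using lead by (simp add: P_def det2_def prod_eq_iff algebra_simps)
  then have "P \<noteq> 0"
    using c det2_word_act_stretch_axis_nonzero[OF K(1) g(1) t A q] by auto
  moreover have "snd q \<in> K'" "- fst q \<in> K'"
    using q(1) K(3) root_closedD(5)[OF K(2)] by (auto simp: mem_Times_iff)
  then have "coeff P i \<in> K'" for i
    unfolding P_def by (rule coeff_combination_in[OF K(2) XY])
  moreover have "poly P (t g) = 0"
    using 0 by (simp add: val P_def det2_def mult.commute)
  ultimately have "t g \<in> K'" using K(2) unfolding root_closed_def by blast
  with g(4) show False ..
qed

section \<open>Words of lifts\<close>

text \<open>The coefficients are the entries of the matrix of \<open>letter s t e\<close>, so
  \<open>turn\<close> is its lift to angles.\<close>

definition turn :: "real \<Rightarrow> real \<Rightarrow> bool \<Rightarrow> real \<Rightarrow> real" where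
  "turn s t e = (if e then angle_lift (t * s\<^sup>2 + 1) ((t - 1) * s) (t + s\<^sup>2)
    else angle_lift (t + s\<^sup>2) (- ((t - 1) * s)) (t * s\<^sup>2 + 1))"

definition walk :: "('i \<Rightarrow> real) \<Rightarrow> ('i \<Rightarrow> real) \<Rightarrow> ('i \<times> bool) list \<Rightarrow> real \<Rightarrow> real" where
  "walk s t w z = foldr (\<lambda>(i, e). turn (s i) (t i) e) w z"

lemma walk_Nil [simp]: "walk s t [] z = z"
  and walk_Cons [simp]: "walk s t ((i, e) # w) z = turn (s i) (t i) e (walk s t w z)"
  by (simp_all add: walk_def)

lemma pos_def_turn: "t > 0 \<Longrightarrow> pos_def (t * s\<^sup>2 + 1) ((t - 1) * s) (t + s\<^sup>2)"
proof -
  assume t: "t > 0"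
  have "(t * s\<^sup>2 + 1) * (t + s\<^sup>2) - ((t - 1) * s)\<^sup>2 = t * (1 + s\<^sup>2)\<^sup>2"
    by (simp add: power2_eq_square algebra_simps)
  moreover have "1 + s\<^sup>2 \<noteq> 0" by (rule one_plus_square_nonzero)
  ultimately show ?thesis using t by (simp add: pos_def_def add_nonneg_pos)
qed

lemma turn_inverse: "t > 0 \<Longrightarrow> turn s t e (turn s t (\<not> e) z) = z"
  using angle_lift_inverse[OF pos_def_turn] angle_lift_inverse[OF pos_def_adj[OF pos_def_turn]]
  by (cases e) (simp_all add: turn_def)

lemma letter_ray:
  assumes "t > 0"
  shows "\<exists>\<rho>>0. letter s t e (cos z, sin z) = \<rho> *\<^sub>R (cos (turn s t e z), sin (turn s t e z))"
proof (cases e)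
  case True
  from angle_lift_action[OF pos_def_turn[OF assms, of s], of z] obtain \<rho> where
    "\<rho> > 0" "(t * s\<^sup>2 + 1) * cos z + (t - 1) * s * sin z = \<rho> * cos (turn s t e z)"
    "(t - 1) * s * cos z + (t + s\<^sup>2) * sin z = \<rho> * sin (turn s t e z)"
    using True by (auto simp: turn_def)
  then show ?thesis
    using True
    by (intro exI[of _ \<rho>]) (simp add: letter_def inner_prod_def stretch_axis_def prod_eq_iff power2_eq_square algebra_simps)
next
  case False
  from angle_lift_action[OF pos_def_adj[OF pos_def_turn[OF assms, of s]], of z] obtain \<rho> where
    "\<rho> > 0" "(t + s\<^sup>2) * cos z + - ((t - 1) * s) * sin z = \<rho> * cos (turn s t e z)"
    "- ((t - 1) * s) * cos z + (t * s\<^sup>2 + 1) * sin z = \<rho> * sin (turn s t e z)"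
    using False by (auto simp: turn_def)
  then show ?thesis
    using False
    by (intro exI[of _ \<rho>]) (simp add: letter_def inner_prod_def stretch_axis_def prod_eq_iff power2_eq_square algebra_simps)
qed

lemma word_act_ray:
  assumes "\<And>i. t i > 0"
  shows "\<exists>\<rho>>0. word_act s t w (cos z, sin z) = \<rho> *\<^sub>R (cos (walk s t w z), sin (walk s t w z))"
proof (induction w)
  case Nil
  show ?case by (intro exI[of _ 1]) simp
next
  case (Cons l w)
  obtain i e where l: "l = (i, e)" by (cases l)
  from Cons obtain \<rho> where \<rho>: "\<rho> > 0"
    "word_act s t w (cos z, sin z) = \<rho> *\<^sub>R (cos (walk s t w z), sin (walk s t w z))" by blast
  from letter_ray[OF assms[of i]] obtain \<sigma> where \<sigma>: "\<sigma> > 0"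
    "letter (s i) (t i) e (cos (walk s t w z), sin (walk s t w z))
      = \<sigma> *\<^sub>R (cos (walk s t (l # w) z), sin (walk s t (l # w) z))"
    unfolding l walk_Cons by metis
  have "word_act s t (l # w) (cos z, sin z)
      = \<rho> *\<^sub>R letter (s i) (t i) e (cos (walk s t w z), sin (walk s t w z))"
    using letter_linear[of "s i" "t i" e \<rho> _ 0 0] by (simp add: l \<rho>(2) del: scaleR_Pair)
  then show ?case using \<rho>(1) \<sigma> by (intro exI[of _ "\<rho> * \<sigma>"]) simp
qed

section \<open>Generic parameters\<close>

lemma small_Un:
  "|A :: real set| <o |UNIV :: real set| \<Longrightarrow> |B| <o |UNIV :: real set| \<Longrightarrow> |A \<union> B| <o |UNIV :: real set|"
  by (rule card_of_Un_ordLess_infinite) (simp_all add: infinite_UNIV_char_0)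

lemma small_finite: "finite A \<Longrightarrow> |A :: real set| <o |UNIV :: real set|"
  using card_of_ordLeq_finite[of "UNIV :: real set" A] infinite_UNIV_char_0
    ordLess_or_ordLeq[OF card_of_Well_order card_of_Well_order] by blast

text \<open>A cardinal is an initial well-order: each \<open>underS real_wo i\<close> is smaller
  than the continuum, so closures of earlier parameters stay proper.\<close>

definition real_wo :: "real rel" where "real_wo = |UNIV|"

lemma real_wo: "Card_order real_wo" "Field real_wo = UNIV" "wf (real_wo - Id)" "Total real_wo" "trans real_wo" "antisym real_wo"
proof -
  show "Card_order real_wo" "Field real_wo = UNIV"
    using card_of_Card_order[of "UNIV :: real set"] by (simp_all add: real_wo_def Field_card_of)
  then show "wf (real_wo - Id)" "Total real_wo" "trans real_wo" "antisym real_wo"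
    by (auto simp: card_order_on_def well_order_on_def linear_order_on_def partial_order_on_def preorder_on_def)
qed

lemma small_image_underS: "|f ` underS real_wo i :: real set| <o |UNIV :: real set|"
proof -
  have "|underS real_wo i| <o |UNIV :: real set|"
    using card_of_underS[OF real_wo(1), of i] real_wo(2) by (simp add: real_wo_def)
  then show ?thesis using card_of_image ordLeq_ordLess_trans by blast
qed

lemma finite_has_real_wo_max:
  assumes "finite S" "S \<noteq> {}"
  shows "\<exists>g\<in>S. S \<subseteq> insert g (underS real_wo g)"
  using assms
proof (induction S rule: finite_ne_induct)
  case (singleton x)
  then show ?case by simp
next
  case (insert x S)
  then obtain g where g: "g \<in> S" "S \<subseteq> insert g (underS real_wo g)" by blast
  then have gx: "g \<noteq> x" using insert by auto
  then consider "(x, g) \<in> real_wo" | "(g, x) \<in> real_wo"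
    using real_wo(2,4) by (auto simp: total_on_def)
  then show ?case
  proof cases
    case 1
    then show ?thesis using g gx by (auto simp: underS_def)
  next
    case 2
    have "S \<subseteq> underS real_wo x"
      using g(2) 2 gx real_wo(5,6) by (auto simp: underS_def dest: transD antisymD)
    then show ?thesis by blast
  qed
qed

text \<open>The \<open>cot (z j)\<close> are included so that the direction
  \<open>(cot (z j), 1)\<close> has coordinates in the closures at all later stages.\<close>

definition earlier :: "(real \<Rightarrow> real) \<Rightarrow> (real \<Rightarrow> real) \<Rightarrow> (real \<Rightarrow> real) \<Rightarrow> real \<Rightarrow> real set" where
  "earlier s t z i = s ` underS real_wo i \<union> t ` underS real_wo i \<union> (\<lambda>j. cot (z j)) ` underS real_wo i"

text \<open>Since \<open>cot z' = 0\<close> by convention where \<open>sin z' = 0\<close>, the condition on \<open>cot z'\<close>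
  also forces \<open>sin z' \<noteq> 0\<close>.\<close>

definition generic_at :: "(real \<Rightarrow> real set) \<Rightarrow> (real \<Rightarrow> real) \<Rightarrow> (real \<Rightarrow> real) \<Rightarrow> (real \<Rightarrow> real) \<Rightarrow>
    real \<Rightarrow> real \<Rightarrow> real \<Rightarrow> real \<Rightarrow> bool" where
  "generic_at N s t z i s' t' z' \<longleftrightarrow> s' \<notin> rcl (earlier s t z i) \<and> t' > 0 \<and>
     t' \<notin> rcl (earlier s t z i \<union> {s'}) \<and> cot z' \<notin> rcl (earlier s t z i \<union> {s', t'}) \<and>
     z' \<notin> N i \<and> turn s' t' True z' \<notin> N i"

lemma ex_generic_at:
  assumes "\<And>i. negligible (N i)"
  shows "\<exists>s' t' z'. generic_at N s t z i s' t' z'"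
proof -
  define A where "A = earlier s t z i"
  have A: "|A| <o |UNIV :: real set|"
    unfolding A_def earlier_def by (intro small_Un small_image_underS)
  then obtain s' where s': "s' \<notin> rcl A" using rcl_ne_UNIV by blast
  have "|A \<union> {s'}| <o |UNIV :: real set|" by (intro small_Un A small_finite) simp
  then obtain t0 where t0: "t0 \<notin> rcl (A \<union> {s'})" using rcl_ne_UNIV by blast
  \<comment> \<open>Root-closed sets are closed under negation, so passing to the absolute value
    stays outside.\<close>
  define t' where "t' = \<bar>t0\<bar>"
  have "t0 \<noteq> 0" using t0 root_closedD(1)[OF root_closed_hull] by metis
  then have t': "t' \<notin> rcl (A \<union> {s'})" "t' > 0"
    using t0 root_closedD(5)[OF root_closed_hull, of "- t0" "A \<union> {s'}"] by (auto simp: t'_def abs_if)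
  have "|A \<union> {s', t'}| <o |UNIV :: real set|" by (intro small_Un A small_finite) simp
  then have "rcl (A \<union> {s', t'}) \<noteq> UNIV" by (rule rcl_ne_UNIV)
  moreover have "negligible (N i \<union> turn s' t' True -` N i)"
    using assms negligible_angle_lift_vimage[OF pos_def_turn[OF t'(2)]] by (simp add: turn_def)
  ultimately obtain z' where "z' \<notin> N i \<union> turn s' t' True -` N i" "cot z' \<notin> rcl (A \<union> {s', t'})"
    using ex_cot_notin[OF root_closed_hull] by blast
  then show ?thesis using s' t' unfolding generic_at_def A_def[symmetric] by blast
qed

lemma ex_generic:
  assumes "\<And>i. negligible (N i)"
  shows "\<exists>s t z. \<forall>i. generic_at N s t z i (s i) (t i) (z i)"
proof -
  define P where "P f i p = generic_at N (\<lambda>j. fst (f j)) (\<lambda>j. fst (snd (f j))) (\<lambda>j. snd (snd (f j))) i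
    (fst p) (fst (snd p)) (snd (snd p))" for f :: "real \<Rightarrow> real \<times> real \<times> real" and i p
  have "\<exists>f. \<forall>i. P f i (f i)"
  proof (rule dependent_wf_choice[OF real_wo(3)])
    fix f g :: "real \<Rightarrow> real \<times> real \<times> real" and i r
    assume eq: "\<And>j. (j, i) \<in> real_wo - Id \<Longrightarrow> f j = g j"
    have "earlier (\<lambda>j. fst (f j)) (\<lambda>j. fst (snd (f j))) (\<lambda>j. snd (snd (f j))) i
        = earlier (\<lambda>j. fst (g j)) (\<lambda>j. fst (snd (g j))) (\<lambda>j. snd (snd (g j))) i"
      unfolding earlier_def using eq by (intro arg_cong2[where f = "(\<union>)"] image_cong refl) (auto simp: underS_def)
    then show "P f i r = P g i r" by (simp add: P_def generic_at_def)
  next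
    fix i and f :: "real \<Rightarrow> real \<times> real \<times> real"
    obtain s' t' z' where "generic_at N (\<lambda>j. fst (f j)) (\<lambda>j. fst (snd (f j))) (\<lambda>j. snd (snd (f j))) i s' t' z'"
      using ex_generic_at[of N, OF assms] by blast
    then show "\<exists>r. P f i r" by (intro exI[of _ "(s', t', z')"]) (simp add: P_def)
  qed
  then show ?thesis unfolding P_def by blast
qed

section \<open>Freeness of generic words\<close>

text \<open>Well-founded induction on the largest index \<open>g\<close>: the prefixes needed in
  \<open>word_act_not_parallel\<close> have indices below \<open>g\<close>. The first claim compares
  the image of \<open>(1, 0)\<close> with both coordinate axes.\<close>

lemma generic_words_free:
  assumes gen: "\<And>i. generic_at N s t z i (s i) (t i) (z i)"
    and w: "reduced w" "fst ` set w \<subseteq> insert g (underS real_wo g)" "g \<in> fst ` set w"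
  shows "fst (word_act s t w (1, 0)) \<noteq> 0 \<and> snd (word_act s t w (1, 0)) \<noteq> 0"
    and "i \<in> underS real_wo g \<Longrightarrow> det2 (word_act s t w (cot (z i), 1)) (cot (z i), 1) \<noteq> 0"
proof -
  have "(fst (word_act s t w (1, 0)) \<noteq> 0 \<and> snd (word_act s t w (1, 0)) \<noteq> 0) \<and>
    (\<forall>i\<in>underS real_wo g. det2 (word_act s t w (cot (z i), 1)) (cot (z i), 1) \<noteq> 0)"
    using w
  proof (induction g arbitrary: w rule: wf_induct_rule[OF real_wo(3)])
    case (1 g)
    define A where "A = earlier s t z g"
    define K K' where "K = rcl A" and "K' = rcl (A \<union> {s g})"
    have K: "root_closed K" "root_closed K'" "K \<subseteq> K'"
      by (auto simp: K_def K'_def root_closed_hull intro!: hull_mono)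
    have tpos: "\<And>i. t i > 0" using gen by (simp add: generic_at_def)
    have g: "s g \<notin> K" "s g \<in> K'" "g \<notin> underS real_wo g" "t g \<notin> K'"
      using gen[of g] by (auto simp: generic_at_def K_def K'_def A_def underS_def hull_inc)
    have AK: "A \<subseteq> K" by (simp add: K_def hull_subset)
    have J: "underS real_wo g \<subseteq> {i. s i \<in> K \<and> t i \<in> K}"
      using AK by (auto simp: A_def earlier_def)
    have IH: "fst (word_act s t B (1, 0)) \<noteq> 0 \<and> snd (word_act s t B (1, 0)) \<noteq> 0"
      if B: "B \<noteq> []" "reduced B" "fst ` set B \<subseteq> underS real_wo g" for B
    proof -
      obtain h where h: "h \<in> fst ` set B" "fst ` set B \<subseteq> insert h (underS real_wo h)"
        using finite_has_real_wo_max[of "fst ` set B"] B(1) by auto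
      then have "(h, g) \<in> real_wo - Id" using B(3) by (auto simp: underS_def)
      then show ?thesis using "1.IH" B(2) h by blast
    qed
    have par: "det2 (word_act s t w p) q \<noteq> 0"
      if "p \<in> K \<times> K" "p \<noteq> 0" "q \<in> K \<times> K" "q \<noteq> 0" for p q
      by (rule word_act_not_parallel[OF K g J tpos IH that "1.prems"])
    have K01: "0 \<in> K" "1 \<in> K" using root_closedD[OF K(1)] by auto
    have "det2 (word_act s t w (1, 0)) (1, 0) \<noteq> 0" "det2 (word_act s t w (1, 0)) (0, 1) \<noteq> 0"
      by (rule par; simp add: K01 zero_prod_def)+
    moreover have "det2 (word_act s t w (cot (z i), 1)) (cot (z i), 1) \<noteq> 0" if "i \<in> underS real_wo g" for i
    proof -
      have "cot (z i) \<in> K" using AK that by (auto simp: A_def earlier_def)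
      then show ?thesis by (intro par) (simp_all add: K01 zero_prod_def)
    qed
    ultimately show ?case by (simp add: det2_def)
  qed
  then show "fst (word_act s t w (1, 0)) \<noteq> 0 \<and> snd (word_act s t w (1, 0)) \<noteq> 0"
    "i \<in> underS real_wo g \<Longrightarrow> det2 (word_act s t w (cot (z i), 1)) (cot (z i), 1) \<noteq> 0"
    by auto
qed

text \<open>A fixed \<open>z i\<close> makes \<open>(x, 1)\<close> an eigenvector. If
  \<open>i\<close> is below the largest index \<open>g\<close>, \<open>generic_words_free\<close>
  excludes this; otherwise the word has entries in \<open>K\<close> and \<open>x\<close> is a root
  of a quadratic over \<open>K\<close> with leading coefficient \<open>- c\<close>, nonzero by the
  same lemma.\<close>

lemma generic_walk_no_fixpoint:
  assumes gen: "\<And>i. generic_at N s t z i (s i) (t i) (z i)"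
    and w: "reduced w" "w \<noteq> []"
  shows "walk s t w (z i) \<noteq> z i"
proof
  assume fixed: "walk s t w (z i) = z i"
  have tpos: "\<And>i. t i > 0" using gen by (simp add: generic_at_def)
  define x K where "x = cot (z i)" and "K = rcl (earlier s t z i \<union> {s i, t i})"
  have K: "root_closed K" by (simp add: K_def root_closed_hull)
  have x: "x \<notin> K" using gen[of i] by (simp add: generic_at_def x_def K_def)
  then have "sin (z i) \<noteq> 0" using root_closedD(1)[OF K] by (auto simp: x_def cot_def)
  then have p: "(x, 1) = (1 / sin (z i)) *\<^sub>R (cos (z i), sin (z i))" by (simp add: x_def cot_def)
  obtain \<rho> where "word_act s t w (cos (z i), sin (z i)) = \<rho> *\<^sub>R (cos (z i), sin (z i))"
    using word_act_ray[of t s w "z i"] tpos fixed by auto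
  then have "word_act s t w (x, 1) = \<rho> *\<^sub>R (x, 1)"
    unfolding p using word_act_linear[of s t w "1 / sin (z i)" _ 0 0]
    by (simp add: mult.commute del: scaleR_Pair)
  then have cross0: "det2 (word_act s t w (x, 1)) (x, 1) = 0" by (simp add: det2_def)
  obtain g where g: "g \<in> fst ` set w" "fst ` set w \<subseteq> insert g (underS real_wo g)"
    using finite_has_real_wo_max[of "fst ` set w"] w(2) by auto
  have "i \<notin> underS real_wo g"
    using generic_words_free(2)[of N s t z w g i, OF gen w(1) g(2,1)] cross0 by (auto simp: x_def)
  then have gi: "g = i \<or> (g, i) \<in> real_wo"
    using real_wo(2,4) by (auto simp: underS_def total_on_def)
  have "insert g (underS real_wo g) \<subseteq> insert i (underS real_wo i)"
    using gi real_wo(5,6) by (auto simp: underS_def dest: transD antisymD)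
  moreover have "earlier s t z i \<union> {s i, t i} \<subseteq> K" by (simp only: K_def hull_subset)
  then have "insert i (underS real_wo i) \<subseteq> {j. s j \<in> K \<and> t j \<in> K}"
    by (auto simp: earlier_def)
  ultimately have wK: "fst ` set w \<subseteq> {j. s j \<in> K \<and> t j \<in> K}"
    using g(2) by blast
  obtain a c where ac: "word_act s t w (1, 0) = (a, c)" by (meson surj_pair)
  obtain b d where bd: "word_act s t w (0, 1) = (b, d)" by (meson surj_pair)
  have in_K: "a \<in> K" "b \<in> K" "c \<in> K" "d \<in> K"
    using word_act_in[OF K wK, of "(1, 0)"] word_act_in[OF K wK, of "(0, 1)"] root_closedD(1,2)[OF K] ac bd
    by auto
  have "c \<noteq> 0" using generic_words_free(1)[of N s t z w g, OF gen w(1) g(2,1)] ac by simp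
  moreover have "word_act s t w (x, 1) = (x * a + b, x * c + d)"
    by (subst word_act_basis) (simp add: ac bd)
  then have "(- c) * x\<^sup>2 + (a - d) * x + b = 0"
    using cross0 by (simp add: det2_def power2_eq_square algebra_simps)
  ultimately have "x \<in> K"
    using root_closed_quadratic_root[OF K root_closedD(5)[OF K in_K(3)] root_closedD(6)[OF K in_K(1,4)] in_K(2)]
    by auto
  with x show False ..
qed

text \<open>A path from the far end of the edge of \<open>i\<close> at \<open>z i\<close> back to \<open>z i\<close>, after cancelling
  backtracking steps, spells a reduced word that fixes \<open>z i\<close>. The initial letter \<open>(i, True)\<close> is never
  cancelled, because the only step that could cancel it is the removed edge itself.\<close>

lemma edge_is_bridge:
  assumes tpos: "\<And>i. t i > 0"
    and free: "\<And>w i. reduced w \<Longrightarrow> w \<noteq> [] \<Longrightarrow> walk s t w (z i) \<noteq> z i"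
    and E: "E = {(y, turn (s j) (t j) True y) | j y. y \<noteq> z j}"
  shows "(turn (s i) (t i) True (z i), z i) \<notin> (E \<union> E\<inverse>)\<^sup>*"
proof
  \<comment> \<open>Words act from the right, so the final letter \<open>(i, True)\<close> is the
    first step and crosses the removed edge.\<close>
  have "\<exists>w. reduced (w @ [(i, True)]) \<and> walk s t (w @ [(i, True)]) (z i) = y"
    if "(turn (s i) (t i) True (z i), y) \<in> (E \<union> E\<inverse>)\<^sup>*" for y
    using that
  proof (induction rule: rtrancl_induct)
    case base
    show ?case by (intro exI[of _ "[]"]) simp
  next
    case (step y y')
    then obtain w where w: "reduced (w @ [(i, True)])" "walk s t (w @ [(i, True)]) (z i) = y" by blast
    \<comment> \<open>\<open>e = False\<close> is a step against an edge; it cannot end at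
      \<open>z j\<close>, because that edge is left out of \<open>E\<close>.\<close>
    obtain j e where je: "y' = turn (s j) (t j) e y" "\<not> e \<Longrightarrow> y' \<noteq> z j"
    proof -
      from step(2) consider "(y, y') \<in> E" | "(y', y) \<in> E" by blast
      then show ?thesis
      proof cases
        case 1
        then obtain j where "y' = turn (s j) (t j) True y" by (auto simp: E)
        then show ?thesis using that[of j True] by simp
      next
        case 2
        then obtain j where "y = turn (s j) (t j) True y'" "y' \<noteq> z j" by (auto simp: E)
        then show ?thesis using that[of j False] turn_inverse[of "t j" "s j" False y'] tpos by simp
      qed
    qed
    show ?case
    proof (cases "hd (w @ [(i, True)]) = (j, \<not> e)")
      case False
      then have "reduced (((j, e) # w) @ [(i, True)])"
        using w(1) by (cases "hd (w @ [(i, True)])") (auto simp: successively_Cons)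
      moreover have "walk s t (((j, e) # w) @ [(i, True)]) (z i) = y'"
        by (simp only: append_Cons walk_Cons w(2) je(1))
      ultimately show ?thesis by blast
    next
      case True
      have undo: "turn (s j) (t j) e (turn (s j) (t j) (\<not> e) v) = v" for v
        by (rule turn_inverse[OF tpos])
      show ?thesis
      proof (cases w)
        case Nil
        then have "j = i" "e = False" using True by simp_all
        then have "y = turn (s j) (t j) (\<not> e) (z j)" using w(2) Nil by simp
        then have "y' = z j" using je(1) undo by simp
        then show ?thesis using je(2) \<open>e = False\<close> by simp
      next
        case (Cons l w')
        then have "y = turn (s j) (t j) (\<not> e) (walk s t (w' @ [(i, True)]) (z i))" using True w(2) by simp
        then have "walk s t (w' @ [(i, True)]) (z i) = y'" using je(1) undo by simp
        moreover have "reduced (w' @ [(i, True)])" using w(1) Cons by (simp add: successively_Cons)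
        ultimately show ?thesis by blast
      qed
    qed
  qed
  moreover assume "(turn (s i) (t i) True (z i), z i) \<in> (E \<union> E\<inverse>)\<^sup>*"
  ultimately show False using free by blast
qed

section \<open>Anonymous prediction of the quotient map\<close>

theorem theorem1p8:
  shows "\<exists>r :: real rel. equiv UNIV r \<and>
    \<not> (\<exists>P. is_predictor (UNIV // r) P \<and> good_predictor (UNIV // r) P
            \<and> anonymous_predictor (UNIV // r) Dinf_Lip P) \<and>
    \<not> (\<exists>Q. is_weak_predictor (UNIV // r) Q \<and> good_weak_predictor (UNIV // r) Q
            \<and> anonymous_weak_predictor (UNIV // r) Dinf_Lip Q)"
proof -
  obtain N :: "real \<Rightarrow> real set" where N: "\<And>i. negligible (N i)" "\<And>B. negligible B \<Longrightarrow> \<exists>i. B \<subseteq> N i"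
    using cofinal_negligible_family by blast
  obtain s t z where gen: "\<And>i. generic_at N s t z i (s i) (t i) (z i)" using ex_generic[of N, OF N(1)] by blast
  then have tpos: "\<And>i. t i > 0" by (simp add: generic_at_def)
  define \<phi> where "\<phi> i = turn (s i) (t i) True" for i
  have \<phi>: "\<phi> i \<in> Dinf_Lip" for i
    using angle_lift_in_Dinf_Lip[OF pos_def_turn[OF tpos]] by (simp add: \<phi>_def turn_def)
  then have mono: "strict_mono (\<phi> i)" for i by (simp add: Dinf_Lip_def)
  define E where "E = {(y, turn (s j) (t j) True y) | j y. y \<noteq> z j}"
  define r where "r = (E \<union> E\<inverse>)\<^sup>*"
  have "sym r" unfolding r_def by (intro sym_rtrancl) (auto simp: sym_def)
  then have equiv: "equiv UNIV r" by (auto simp: r_def intro!: equivI refl_rtrancl trans_rtrancl)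
  define F where "F y = r `` {y}" for y
  have F_range: "range F \<subseteq> UNIV // r" by (auto simp: F_def quotient_def)
  have F_eq: "F y = F y' \<longleftrightarrow> (y, y') \<in> r" for y y'
    unfolding F_def using eq_equiv_class_iff[OF equiv] by simp
  have F_edge: "F (\<phi> i y) = F y" if "y \<noteq> z i" for i y
  proof -
    have "(y, \<phi> i y) \<in> E" using that by (auto simp: E_def \<phi>_def)
    then have "(y, \<phi> i y) \<in> r" by (auto simp: r_def)
    then show ?thesis using F_eq by metis
  qed
  have F_bridge: "F (\<phi> i (z i)) \<noteq> F (z i)" for i
    unfolding F_eq using edge_is_bridge[of t s z E i, OF tpos _ E_def] generic_walk_no_fixpoint[of N s t z, OF gen]
    by (simp add: r_def \<phi>_def)
  have avoid: "\<exists>i. z i \<notin> B \<and> \<phi> i (z i) \<notin> B" if B: "B \<in> null_sets lebesgue" for B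
  proof -
    obtain i where "B \<subseteq> N i" using N(2) B negligible_iff_null_sets by blast
    then show ?thesis using gen[of i] by (auto simp: generic_at_def \<phi>_def)
  qed
  have "False" if P: "good_predictor (UNIV // r) P" "anonymous_predictor (UNIV // r) Dinf_Lip P" for P
  proof -
    \<comment> \<open>The error set for \<open>F\<close> is null, so it misses both ends of some
      removed edge.\<close>
    from P(1) F_range obtain i where "P ((Some \<circ> F) |` {..<z i}) = F (z i)"
      "P ((Some \<circ> F) |` {..<\<phi> i (z i)}) = F (\<phi> i (z i))"
      using avoid unfolding good_predictor_def by blast
    moreover have "P ((Some \<circ> F) |` {..<\<phi> i (z i)}) = P (((Some \<circ> F) |` {..<\<phi> i (z i)}) \<circ> \<phi> i)"
    proof -
      have "dom ((Some \<circ> F) |` {..<\<phi> i (z i)}) = {..<\<phi> i (z i)}" "ran ((Some \<circ> F) |` {..<\<phi> i (z i)}) \<subseteq> UNIV // r"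
        using F_range by (auto simp: ran_def restrict_map_def split: if_splits)
      then show ?thesis using P(2) \<phi> unfolding anonymous_predictor_def by blast
    qed
    \<comment> \<open>As \<open>\<phi> i\<close> is increasing,
      \<open>\<phi> i y < \<phi> i (z i)\<close> means \<open>y < z i\<close>; such a
      \<open>y\<close> is not \<open>z i\<close>, so \<open>F\<close> agrees at \<open>y\<close> and
      \<open>\<phi> i y\<close>.\<close>
    moreover have "((Some \<circ> F) |` {..<\<phi> i (z i)}) \<circ> \<phi> i = (Some \<circ> F) |` {..<z i}"
      using strict_mono_less[OF mono] F_edge by (auto simp: fun_eq_iff restrict_map_def)
    ultimately show False using F_bridge by metis
  qed
  moreover have "False" if Q: "good_weak_predictor (UNIV // r) Q" "anonymous_weak_predictor (UNIV // r) Dinf_Lip Q" for Q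
  proof -
    from Q(1) F_range obtain i where "Q ((Some \<circ> F) |` (- {z i})) = F (z i)"
      "Q ((Some \<circ> F) |` (- {\<phi> i (z i)})) = F (\<phi> i (z i))"
      using avoid unfolding good_weak_predictor_def by blast
    moreover have "Q ((Some \<circ> F) |` (- {z i})) = Q ((Some \<circ> F) |` (- {\<phi> i (z i)}))"
    proof -
      have D: "dom ((Some \<circ> F) |` (- {y})) = - {y}" "ran ((Some \<circ> F) |` (- {y})) \<subseteq> UNIV // r" for y
        using F_range by (auto simp: ran_def restrict_map_def split: if_splits)
      \<comment> \<open>The two-sided version needs invariance of \<open>F\<close> at every
        \<open>y\<close> other than \<open>z i\<close>, which is what \<open>F_edge\<close>
        gives.\<close>
      have eq: "(Some \<circ> F) |` (- {z i}) = (((Some \<circ> F) |` (- {\<phi> i (z i)})) \<circ> \<phi> i) |` (- {z i})"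
        using strict_mono_eq[OF mono] F_edge by (auto simp: fun_eq_iff restrict_map_def)
      show ?thesis
        by (rule Q(2)[unfolded anonymous_weak_predictor_def, rule_format, of _ "z i" _ "\<phi> i (z i)" "\<phi> i"])
          (use D(1)[of "z i"] D(1)[of "\<phi> i (z i)"] D(2) \<phi>[of i] eq in metis)
    qed
    ultimately show False using F_bridge by metis
  qed
  ultimately show ?thesis using equiv by (intro exI[of _ r]) blast
qed

end
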